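(* Let $B\subset\Lambda$ be a noise-type Boolean algebra, let $\mathrm{Cl}(B)=\{\liminf_n x_n : x_1,x_2,\ldots\in B\}$, and let $$C=\bigl\{x\in\mathrm{Cl}(B) : \exists\, y\in\mathrm{Cl}(B)\ \ x\wedge y=0_\Lambda,\ x\vee y=1_\Lambda\bigr\}.$$ Then: (a) $C$ is a noise-type Boolean algebra such that $B\subset C\subset\mathrm{Cl}(B)$; (b) $C$ contains every noise-type Boolean algebra $C_1$ satisfying $B\subset C_1\subset\mathrm{Cl}(B)$.
   Context: Let $(\Omega,\mathcal F,P)$ be a probability space with $H=L_2(\Omega,\mathcal F,P)$ (real-valued functions) separable. Every $\sigma$-field is assumed to contain all null sets. $\Lambda$ is the set of all sub-$\sigma$-fields of $\mathcal F$, partially ordered by inclusion; it is a complete lattice with $x\wedge y=x\cap y$, $x\vee y=\sigma(x,y)$ (the least $\sigma$-field containing $x$ and $y$), $\inf X=\bigcap_{x\in X}x$, $\sup X=\sigma(\bigcup_{x\in X}x)$ for $X\subset\Lambda$; its greatest element is $1_\Lambda=\mathcal F$ and its least element $0_\Lambda$ is the trivial $\sigma$-field (null sets and their complements). For arbitrary $x_1,x_2,\ldots\in\Lambda$, $\liminf_n x_n=\sup_n\inf_k x_{n+k}$. A noise-type Boolean algebra is a subset $B\subset\Lambda$ that is a sublattice (closed under $\wedge,\vee$), is distributive ($x\wedge(y\vee z)=(x\wedge y)\vee(x\wedge z)$ for $x,y,z\in B$), contains $0_\Lambda$ and $1_\Lambda$, is such that every $x\in B$ has a (necessarily unique) complement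 $x'\in B$ ($x\wedge x'=0_\Lambda$, $x\vee x'=1_\Lambda$), and such that for every $x\in B$ the $\sigma$-fields $x$ and $x'$ are independent. *)

theory Defs
  imports "HOL-Probability.Probability"
begin

text \<open>
  Sub-sigma-fields of \<open>sets M\<close> are represented by their sets of events. ``All null sets'' are the
  measurable null sets \<open>null_sets M\<close>; the measure space \<open>M\<close> itself is not required to be complete.
  The order is inclusion, and the meet of two sigma-fields is their intersection.
\<close>

definition sigma_fields :: "'a measure \<Rightarrow> 'a set set set" where
  "sigma_fields M =
    {x. sigma_algebra (space M) x \<and> x \<subseteq> sets M \<and> null_sets M \<subseteq> x}"

definition trivial_field :: "'a measure \<Rightarrow> 'a set set" where
  "trivial_field M = null_sets M \<union> {space M - N | N. N \<in> null_sets M}"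

text \<open>
  The null sets among the generators matter only for the supremum of the empty family.
\<close>

definition sup_field :: "'a measure \<Rightarrow> 'a set set set \<Rightarrow> 'a set set" where
  "sup_field M X = sigma_sets (space M) (null_sets M \<union> \<Union>X)"

definition join_field :: "'a measure \<Rightarrow> 'a set set \<Rightarrow> 'a set set \<Rightarrow> 'a set set" where
  "join_field M x y = sup_field M {x, y}"

definition liminf_field :: "'a measure \<Rightarrow> (nat \<Rightarrow> 'a set set) \<Rightarrow> 'a set set" where
  "liminf_field M x = sup_field M (range (\<lambda>n. \<Inter>k. x (n + k)))"

lemma sup_field_in_sigma_fields:
  assumes "X \<subseteq> sigma_fields M"
  shows "sup_field M X \<in> sigma_fields M"
proof -
  have gen: "null_sets M \<union> \<Union>X \<subseteq> sets M"
    using assms by (auto simp: sigma_fields_def null_sets_def)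
  then have "null_sets M \<union> \<Union>X \<subseteq> Pow (space M)"
    using sets.space_closed by blast
  from sigma_algebra_sigma_sets[OF this] sets.sigma_sets_subset[OF gen]
  show ?thesis
    by (simp add: sigma_fields_def sup_field_def subset_iff)
qed

lemma sup_field_upper: "x \<in> X \<Longrightarrow> x \<subseteq> sup_field M X"
  by (auto simp: sup_field_def)

lemma sup_field_least:
  assumes "y \<in> sigma_fields M" "\<And>x. x \<in> X \<Longrightarrow> x \<subseteq> y"
  shows "sup_field M X \<subseteq> y"
  unfolding sup_field_def
  by (rule sigma_algebra.sigma_sets_subset) (use assms in \<open>auto simp: sigma_fields_def\<close>)

definition L2_functions :: "'a measure \<Rightarrow> ('a \<Rightarrow> real) set" where
  "L2_functions M = {f \<in> borel_measurable M. integrable M (\<lambda>\<omega>. (f \<omega>)\<^sup>2)}"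

text \<open>
  Separability of the Hilbert space of classes of square-integrable functions modulo equality
  almost everywhere, expressed through representatives of the classes.
\<close>

definition separable_L2 :: "'a measure \<Rightarrow> bool" where
  "separable_L2 M \<longleftrightarrow>
    (\<exists>D. countable D \<and> D \<subseteq> L2_functions M \<and>
      (\<forall>f\<in>L2_functions M. \<forall>e>0. \<exists>g\<in>D. sqrt (\<integral>\<omega>. (f \<omega> - g \<omega>)\<^sup>2 \<partial>M) < e))"

definition complementary :: "'a measure \<Rightarrow> 'a set set \<Rightarrow> 'a set set \<Rightarrow> bool" where
  "complementary M x y \<longleftrightarrow> x \<inter> y = trivial_field M \<and> join_field M x y = sets M"

definition noise_type_boolean_algebra :: "'a measure \<Rightarrow> 'a set set set \<Rightarrow> bool" where
  "noise_type_boolean_algebra M B \<longleftrightarrow>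
    B \<subseteq> sigma_fields M \<and>
    (\<forall>x\<in>B. \<forall>y\<in>B. x \<inter> y \<in> B) \<and>
    (\<forall>x\<in>B. \<forall>y\<in>B. join_field M x y \<in> B) \<and>
    (\<forall>x\<in>B. \<forall>y\<in>B. \<forall>z\<in>B.
      x \<inter> join_field M y z = join_field M (x \<inter> y) (x \<inter> z)) \<and>
    trivial_field M \<in> B \<and>
    sets M \<in> B \<and>
    (\<forall>x\<in>B. \<exists>x'\<in>B. complementary M x x') \<and>
    (\<forall>x\<in>B. \<forall>x'\<in>B. complementary M x x' \<longrightarrow> prob_space.indep_set M x x')"

definition noise_closure :: "'a measure \<Rightarrow> 'a set set set \<Rightarrow> 'a set set set" where
  "noise_closure M B = {liminf_field M x | x. \<forall>n. x n \<in> B}"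

definition noise_completion :: "'a measure \<Rightarrow> 'a set set set \<Rightarrow> 'a set set set" where
  "noise_completion M B =
    {x \<in> noise_closure M B. \<exists>y\<in>noise_closure M B. complementary M x y}"

end

theory Submission
  imports Defs
begin

text \<open>
  Let \<open>Q x\<close> denote conditional expectation with respect to the sigma-field \<open>x\<close>, acting on integrable
  functions, and say that \<open>X n\<close> tends to \<open>x\<close> if \<open>Q (X n) f\<close> tends to \<open>Q x f\<close> in mean for every
  integrable \<open>f\<close> (\<open>sf_tendsto\<close>). Two sigma-fields are said to commute if \<open>Q x\<close> preserves
  \<open>y\<close>-measurability (\<open>preserves\<close>); this is a symmetric relation and means that \<open>Q x\<close> composed with
  \<open>Q y\<close> is \<open>Q (x \<inter> y)\<close>. The members of a noise-type Boolean algebra \<open>B\<close> commute, because \<open>y\<close> is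
  generated by the independent parts \<open>y \<inter> x\<close> and \<open>y \<inter> x'\<close>, and \<open>Q x\<close> fixes the first and averages
  the second.

  The first step replaces lower limits by this convergence: the closure \<open>Cl B\<close> consists of all limits
  of sequences in \<open>B\<close> (\<open>noise_closure_eq_strong_closure\<close>). A lower limit is an increasing limit of
  decreasing limits, and monotone sequences converge (\<open>sf_tendsto_decreasing\<close>,
  \<open>sf_tendsto_increasing\<close>). In the other direction, a sequence in \<open>B\<close> that tends to \<open>x\<close> fast enough on a
  dense sequence of functions has \<open>x\<close> as its lower limit; separability provides the dense sequence.
  Consequently \<open>Cl B\<close> is closed under limits, its members commute, it is closed under meets, and
  two of its members with trivial meet are independent.

  The difficulty is the join, which is not continuous: \<open>X n\<close> may decrease to the trivial sigma-field
  while the join of \<open>X n\<close> with some fixed \<open>v\<close> stays equal to everything. It is continuous, however,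
  when \<open>v\<close> and \<open>v'\<close> are independent and generate everything and all \<open>X n\<close> are contained in \<open>v'\<close>,
  because then conditional expectations factorise (\<open>sf_tendsto_join\<close>). To use this one has to split
  sigma-fields: for \<open>x\<close> in \<open>Cl B\<close> and complementary \<open>y\<close>, \<open>y'\<close> in \<open>Cl B\<close>, the sigma-field \<open>x\<close> is the
  join of \<open>x \<inter> y\<close> and \<open>x \<inter> y'\<close> (\<open>strong_closure_split\<close>). If \<open>y\<close> and \<open>y'\<close> are in \<open>B\<close>, this follows
  from distributivity in \<open>B\<close> by a limit. If instead \<open>x\<close> is a member \<open>b\<close> of \<open>B\<close>, then \<open>y\<close> and \<open>y'\<close> split
  along \<open>b\<close> and its complement, so that the parts of \<open>y\<close> and \<open>y'\<close> inside \<open>b\<close> already generate \<open>b\<close>. The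
  general case follows by a second limit.

  Now let \<open>v\<close> have a complement \<open>v'\<close> in \<open>Cl B\<close>. For \<open>b\<close> in \<open>B\<close>, the join of \<open>b\<close> and \<open>v\<close> is a limit of
  members of \<open>B\<close>, since only the part of \<open>v\<close> in the complement of \<open>b\<close> matters; and the join of \<open>x\<close> and
  \<open>v\<close> is a limit of joins of members of \<open>B\<close> with \<open>v\<close>, since only the part of \<open>x\<close> in \<open>v'\<close> matters. Hence
  it is in \<open>Cl B\<close> (\<open>strong_closure_join\<close>). In particular the join of \<open>x'\<close> and \<open>y'\<close> is available as a
  complement of \<open>x \<inter> y\<close>, and distributivity is another consequence of splitting. Maximality is
  immediate from the definition of the completion.
\<close>

context prob_space
begin

section \<open>Mean distance and conditional expectation\<close>
abbreviation fld :: "'a set set \<Rightarrow> 'a measure" where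
  "fld x \<equiv> sigma (space M) x"

definition cexp :: "'a set set \<Rightarrow> ('a \<Rightarrow> real) \<Rightarrow> 'a \<Rightarrow> real" where
  "cexp x f = real_cond_exp M (fld x) f"

text \<open>
  The distance of the mean norm. It is only a pseudometric on functions; distance zero is equality
  almost everywhere.
\<close>
definition l1 :: "('a \<Rightarrow> real) \<Rightarrow> ('a \<Rightarrow> real) \<Rightarrow> real" where
  "l1 f g = (\<integral>\<omega>. \<bar>f \<omega> - g \<omega>\<bar> \<partial>M)"

lemma integrable_indicator_event [simp]:
  assumes "A \<in> sets M"
  shows "integrable M (indicator A :: 'a \<Rightarrow> real)"
  using assms by (simp add: less_top[symmetric])

lemma l1_nonneg [simp]: "0 \<le> l1 f g"
  by (simp add: l1_def)

lemma l1_commute: "l1 f g = l1 g f"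
  by (simp add: l1_def abs_minus_commute)

lemma l1_triangle:
  assumes "integrable M f" "integrable M g" "integrable M h"
  shows "l1 f h \<le> l1 f g + l1 g h"
proof -
  have "l1 f h \<le> (\<integral>\<omega>. \<bar>f \<omega> - g \<omega>\<bar> + \<bar>g \<omega> - h \<omega>\<bar> \<partial>M)"
    unfolding l1_def by (rule integral_mono) (use assms in auto)
  also have "\<dots> = l1 f g + l1 g h"
    unfolding l1_def by (rule Bochner_Integration.integral_add) (use assms in auto)
  finally show ?thesis .
qed

lemma l1_cong_AE:
  assumes "AE \<omega> in M. f \<omega> = f' \<omega>" "AE \<omega> in M. g \<omega> = g' \<omega>"
    "integrable M f" "integrable M f'" "integrable M g" "integrable M g'"
  shows "l1 f g = l1 f' g'"
  unfolding l1_def by (rule integral_cong_AE) (use assms in auto)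

lemma l1_eq_0_AE:
  assumes "integrable M f" "integrable M g" "l1 f g \<le> 0"
  shows "AE \<omega> in M. f \<omega> = g \<omega>"
proof -
  have "l1 f g = 0" using assms(3) l1_nonneg[of f g] by linarith
  then have "AE \<omega> in M. \<bar>f \<omega> - g \<omega>\<bar> = 0"
    using assms(1,2) unfolding l1_def by (subst (asm) integral_nonneg_eq_0_iff_AE) auto
  then show ?thesis by auto
qed

lemma l1_limit_unique:
  assumes "integrable M f" "integrable M g" "\<And>n. integrable M (s n)"
    and "(\<lambda>n. l1 (s n) f) \<longlonglongrightarrow> 0" "(\<lambda>n. l1 (s n) g) \<longlonglongrightarrow> 0"
  shows "AE \<omega> in M. f \<omega> = g \<omega>"
proof (rule l1_eq_0_AE)
  have "(\<lambda>n. l1 (s n) f + l1 (s n) g) \<longlonglongrightarrow> 0 + 0"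
    by (intro tendsto_add assms)
  then show "l1 f g \<le> 0"
    using l1_triangle[OF assms(1) assms(3) assms(2)] l1_commute[of f]
    by (intro LIMSEQ_le_const) auto
qed (use assms in auto)

lemma space_fld: "space (fld x) = space M"
  by (simp add: space_measure_of_conv)

lemma sets_fld: "x \<in> sigma_fields M \<Longrightarrow> sets (fld x) = x"
  unfolding sigma_fields_def by (simp add: sigma_algebra.sets_measure_of_eq)

lemma subalgebra_fld: "x \<in> sigma_fields M \<Longrightarrow> subalgebra M (fld x)"
  unfolding subalgebra_def by (simp add: sets_fld space_fld) (simp add: sigma_fields_def)

lemma sigma_finite_subalgebra_fld:
  assumes "x \<in> sigma_fields M"
  shows "sigma_finite_subalgebra M (fld x)"
proof -
  interpret finite_measure_subalgebra M "fld x"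
    by unfold_locales (rule subalgebra_fld[OF assms])
  show ?thesis by unfold_locales
qed

lemma measurable_fld_mono:
  assumes "x \<subseteq> y" "x \<in> sigma_fields M" "y \<in> sigma_fields M" "f \<in> borel_measurable (fld x)"
  shows "f \<in> borel_measurable (fld y)"
  using assms by (auto simp: measurable_def sets_fld space_fld)

lemma measurable_fld_M:
  assumes "x \<in> sigma_fields M" "f \<in> borel_measurable (fld x)"
  shows "f \<in> borel_measurable M"
  using measurable_from_subalg[OF subalgebra_fld] assms by auto

lemma indicator_measurable_fld_iff:
  assumes "x \<in> sigma_fields M" "A \<subseteq> space M"
  shows "(indicator A :: 'a \<Rightarrow> real) \<in> borel_measurable (fld x) \<longleftrightarrow> A \<in> x"
  using assms by (simp add: borel_measurable_indicator_iff sets_fld space_fld Int_absorb2)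

lemma sigma_field_space: "x \<in> sigma_fields M \<Longrightarrow> space M \<in> x"
  and sigma_field_events: "x \<in> sigma_fields M \<Longrightarrow> A \<in> x \<Longrightarrow> A \<in> sets M"
  and sigma_field_Int: "x \<in> sigma_fields M \<Longrightarrow> A \<in> x \<Longrightarrow> B \<in> x \<Longrightarrow> A \<inter> B \<in> x"
  using sets_fld[of x] sets.top[of "fld x"] sets.Int[of A "fld x" B]
  by (auto simp: sigma_fields_def space_fld)

lemma cexp_integrable:
  assumes "x \<in> sigma_fields M" "integrable M f"
  shows "integrable M (cexp x f)"
  unfolding cexp_def
  by (rule sigma_finite_subalgebra.real_cond_exp_int[OF sigma_finite_subalgebra_fld]) fact+

lemma cexp_measurable [measurable]: "cexp x f \<in> borel_measurable (fld x)"
  by (simp add: cexp_def)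

lemma cexp_add:
  assumes "x \<in> sigma_fields M" "integrable M f" "integrable M g"
  shows "AE \<omega> in M. cexp x (\<lambda>\<omega>. f \<omega> + g \<omega>) \<omega> = cexp x f \<omega> + cexp x g \<omega>"
  unfolding cexp_def
  by (rule sigma_finite_subalgebra.real_cond_exp_add[OF sigma_finite_subalgebra_fld]) fact+

lemma cexp_diff:
  assumes "x \<in> sigma_fields M" "integrable M f" "integrable M g"
  shows "AE \<omega> in M. cexp x (\<lambda>\<omega>. f \<omega> - g \<omega>) \<omega> = cexp x f \<omega> - cexp x g \<omega>"
  unfolding cexp_def
  by (rule sigma_finite_subalgebra.real_cond_exp_diff[OF sigma_finite_subalgebra_fld]) fact+

lemma cexp_cmult:
  assumes "x \<in> sigma_fields M" "integrable M f"
  shows "AE \<omega> in M. cexp x (\<lambda>\<omega>. c * f \<omega>) \<omega> = c * cexp x f \<omega>"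
  unfolding cexp_def
  by (rule sigma_finite_subalgebra.real_cond_exp_cmult[OF sigma_finite_subalgebra_fld]) fact+

lemma cexp_fixes:
  assumes "x \<in> sigma_fields M" "integrable M f" "f \<in> borel_measurable (fld x)"
  shows "AE \<omega> in M. cexp x f \<omega> = f \<omega>"
  unfolding cexp_def
  by (rule sigma_finite_subalgebra.real_cond_exp_F_meas[OF sigma_finite_subalgebra_fld]) fact+

lemma cexp_unique:
  assumes "x \<in> sigma_fields M" "integrable M f" "integrable M g" "g \<in> borel_measurable (fld x)"
    and "\<And>A. A \<in> x \<Longrightarrow> (\<integral>\<omega>\<in>A. f \<omega> \<partial>M) = (\<integral>\<omega>\<in>A. g \<omega> \<partial>M)"
  shows "AE \<omega> in M. cexp x f \<omega> = g \<omega>"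
  unfolding cexp_def
  by (rule sigma_finite_subalgebra.real_cond_exp_charact[OF sigma_finite_subalgebra_fld])
    (use assms in \<open>auto simp: sets_fld\<close>)

lemma cexp_tower:
  assumes "x \<in> sigma_fields M" "y \<in> sigma_fields M" "x \<subseteq> y" "integrable M f"
  shows "AE \<omega> in M. cexp x (cexp y f) \<omega> = cexp x f \<omega>"
  unfolding cexp_def
proof (rule sigma_finite_subalgebra.real_cond_exp_nested_subalg[OF sigma_finite_subalgebra_fld])
  show "subalgebra (fld y) (fld x)"
    using assms by (simp add: subalgebra_def sets_fld space_fld)
qed (use assms subalgebra_fld in auto)

lemma cexp_l1_contraction:
  assumes x: "x \<in> sigma_fields M" and f: "integrable M f" and g: "integrable M g"
  shows "l1 (cexp x f) (cexp x g) \<le> l1 f g"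
proof -
  interpret sigma_finite_subalgebra M "fld x" by (rule sigma_finite_subalgebra_fld[OF x])
  define h where "h = (\<lambda>\<omega>. f \<omega> - g \<omega>)"
  have h: "integrable M h" using f g by (simp add: h_def)
  have "AE \<omega> in M. cexp x h \<omega> \<le> cexp x (\<lambda>\<omega>. \<bar>h \<omega>\<bar>) \<omega>"
    unfolding cexp_def by (rule real_cond_exp_mono) (use h in auto)
  moreover have "AE \<omega> in M. cexp x (\<lambda>\<omega>. (-1) * h \<omega>) \<omega> \<le> cexp x (\<lambda>\<omega>. \<bar>h \<omega>\<bar>) \<omega>"
    unfolding cexp_def by (rule real_cond_exp_mono) (use h in auto)
  moreover note cexp_cmult[OF x h, of "-1"] cexp_diff[OF x f g]
  ultimately have "AE \<omega> in M. \<bar>cexp x f \<omega> - cexp x g \<omega>\<bar> \<le> cexp x (\<lambda>\<omega>. \<bar>h \<omega>\<bar>) \<omega>"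
    by eventually_elim (simp add: h_def abs_le_iff)
  then have "l1 (cexp x f) (cexp x g) \<le> (\<integral>\<omega>. cexp x (\<lambda>\<omega>. \<bar>h \<omega>\<bar>) \<omega> \<partial>M)"
    unfolding l1_def by (intro integral_mono_AE) (use x f g h cexp_integrable in auto)
  also have "\<dots> = l1 f g"
    unfolding cexp_def l1_def by (subst real_cond_exp_int(2)) (use h in \<open>auto simp: h_def\<close>)
  finally show ?thesis .
qed

text \<open>
  This is where the convention enters that every sigma-field contains all null sets: measurability
  with respect to a sigma-field becomes a property of classes of functions.
\<close>
lemma measurable_fld_AE:
  fixes f g :: "'a \<Rightarrow> real"
  assumes x: "x \<in> sigma_fields M" and f: "f \<in> borel_measurable (fld x)"
    and g: "g \<in> borel_measurable M" and eq: "AE \<omega> in M. f \<omega> = g \<omega>"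
  shows "g \<in> borel_measurable (fld x)"
proof (rule measurableI)
  fix U :: "real set" assume U: "U \<in> sets borel"
  have f': "f \<in> borel_measurable M" by (rule measurable_fld_M[OF x f])
  define N where "N = {\<omega> \<in> space M. f \<omega> \<noteq> g \<omega>}"
  have "N \<in> sets M" unfolding N_def by (rule borel_measurable_neq[OF f' g])
  then have N: "N \<in> null_sets M"
    using eq unfolding N_def by (subst (asm) AE_iff_null) auto
  have null_in: "N' \<in> sets (fld x)" if "N' \<subseteq> N" "N' \<in> sets M" for N'
    using null_sets_subset[OF N that(2,1)] x by (auto simp: sets_fld sigma_fields_def)
  have gU: "g -` U \<inter> space M \<in> sets M" using g U by (rule measurable_sets)
  have "f -` U \<inter> space M \<in> sets (fld x)"
    using measurable_sets[OF f U] by (simp add: space_fld)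
  moreover have "N \<in> sets (fld x)" using N null_in by auto
  moreover have "g -` U \<inter> space M \<inter> N \<in> sets (fld x)"
    using null_in gU N by (metis inf_le2 null_setsD2 sets.Int)
  moreover have "g -` U \<inter> space M = (f -` U \<inter> space M - N) \<union> (g -` U \<inter> space M \<inter> N)"
    by (auto simp: N_def)
  ultimately show "g -` U \<inter> space (fld x) \<in> sets (fld x)"
    by (metis sets.Diff sets.Un space_fld)
qed auto

lemma measurable_fldI_cexp:
  assumes "x \<in> sigma_fields M" "integrable M f" "AE \<omega> in M. cexp x f \<omega> = f \<omega>"
  shows "f \<in> borel_measurable (fld x)"
  by (rule measurable_fld_AE[OF assms(1) cexp_measurable borel_measurable_integrable[OF assms(2)] assms(3)])

text \<open>
  Measurable functions are the fixed points of the contraction \<open>cexp x\<close>, hence form a closed set.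
\<close>
lemma measurable_fld_l1_closed:
  assumes x: "x \<in> sigma_fields M" and f: "integrable M f" and s: "\<And>n. integrable M (s n)"
    and meas: "\<And>n. s n \<in> borel_measurable (fld x)" and lim: "(\<lambda>n. l1 (s n) f) \<longlonglongrightarrow> 0"
  shows "f \<in> borel_measurable (fld x)"
proof (rule measurable_fldI_cexp[OF x f])
  have "l1 (s n) (cexp x f) \<le> l1 (s n) f" for n
  proof -
    have "l1 (cexp x (s n)) (cexp x f) = l1 (s n) (cexp x f)"
      by (rule l1_cong_AE[OF cexp_fixes[OF x s meas]]) (simp_all add: cexp_integrable x s f)
    then show ?thesis using cexp_l1_contraction[OF x s[of n] f] by simp
  qed
  then have "(\<lambda>n. l1 (s n) (cexp x f)) \<longlonglongrightarrow> 0"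
    by (intro tendsto_sandwich[OF _ _ tendsto_const lim]) auto
  with lim show "AE \<omega> in M. cexp x f \<omega> = f \<omega>"
    by (intro l1_limit_unique[of _ _ s]) (use cexp_integrable[OF x] s f in auto)
qed

section \<open>A monotone class principle for integrable functions\<close>
lemma l1_dominated_convergence:
  assumes s: "\<And>n. integrable M (s n)" and f: "integrable M f" and w: "integrable M w"
    and lim: "\<And>\<omega>. \<omega> \<in> space M \<Longrightarrow> (\<lambda>n. s n \<omega>) \<longlonglongrightarrow> f \<omega>"
    and bound: "\<And>n \<omega>. \<omega> \<in> space M \<Longrightarrow> \<bar>s n \<omega>\<bar> \<le> w \<omega>"
  shows "(\<lambda>n. l1 (s n) f) \<longlonglongrightarrow> 0"
proof -
  have "(\<lambda>n. \<integral>\<omega>. \<bar>s n \<omega> - f \<omega>\<bar> \<partial>M) \<longlonglongrightarrow> (\<integral>\<omega>. 0 \<partial>M)"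
  proof (rule integral_dominated_convergence[where w="\<lambda>\<omega>. w \<omega> + \<bar>f \<omega>\<bar>"])
    show "AE \<omega> in M. (\<lambda>n. \<bar>s n \<omega> - f \<omega>\<bar>) \<longlonglongrightarrow> 0"
    proof (rule AE_I2)
      fix \<omega> assume "\<omega> \<in> space M"
      then have "(\<lambda>n. \<bar>s n \<omega> - f \<omega>\<bar>) \<longlonglongrightarrow> \<bar>f \<omega> - f \<omega>\<bar>" by (intro tendsto_intros lim)
      then show "(\<lambda>n. \<bar>s n \<omega> - f \<omega>\<bar>) \<longlonglongrightarrow> 0" by simp
    qed
    show "AE \<omega> in M. norm \<bar>s n \<omega> - f \<omega>\<bar> \<le> w \<omega> + \<bar>f \<omega>\<bar>" for n
    proof (rule AE_I2)
      fix \<omega> assume "\<omega> \<in> space M"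
      from bound[OF this, of n] show "norm \<bar>s n \<omega> - f \<omega>\<bar> \<le> w \<omega> + \<bar>f \<omega>\<bar>" by simp
    qed
  qed (use s f w borel_measurable_integrable in auto)
  then show ?thesis by (simp add: l1_def)
qed

text \<open>
  Properties that are linear and closed under convergence in mean need only be checked on the
  indicators of a generating pi-system. Almost all identities and limits below are reduced in this
  way to indicators, for most of them to indicators of \<open>A \<inter> B\<close> with \<open>A\<close> and \<open>B\<close> from two sigma-fields.
\<close>
lemma l1_class_induct:
  assumes G: "Int_stable G" "G \<subseteq> sets M" "space M \<in> G"
    and f: "integrable M f" "f \<in> borel_measurable (fld G)"
    and base: "\<And>A. A \<in> G \<Longrightarrow> P (indicator A)"
    and add: "\<And>f g. integrable M f \<Longrightarrow> integrable M g \<Longrightarrow> P f \<Longrightarrow> P g \<Longrightarrow> P (\<lambda>\<omega>. f \<omega> + g \<omega>)"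
    and cmult: "\<And>c f. integrable M f \<Longrightarrow> P f \<Longrightarrow> P (\<lambda>\<omega>. c * f \<omega>)"
    and lim: "\<And>f s. integrable M f \<Longrightarrow> (\<And>n. integrable M (s n)) \<Longrightarrow> (\<And>n. P (s n)) \<Longrightarrow>
      (\<lambda>n. l1 (s n) f) \<longlonglongrightarrow> 0 \<Longrightarrow> P f"
  shows "P (f :: 'a \<Rightarrow> real)"
proof -
  have GP: "G \<subseteq> Pow (space M)" using G(2) sets.space_closed by auto
  have sub: "subalgebra M (fld G)"
    using G(2) GP by (simp add: subalgebra_def space_fld sets.sigma_sets_subset)
  have sigG: "A \<in> sets M" if "A \<in> sigma_sets (space M) G" for A
    using that sets.sigma_sets_subset[OF G(2)] by auto
  have AEP: "P g" if "P f" "integrable M f" "integrable M g" "AE \<omega> in M. f \<omega> = g \<omega>" for f g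
  proof (rule lim[of g "\<lambda>_. f"])
    have "l1 f g = l1 g g" by (rule l1_cong_AE) (use that in auto)
    then show "(\<lambda>n. l1 f g) \<longlonglongrightarrow> 0" by (simp add: l1_def)
  qed (use that in auto)
  have ind: "P (indicator A)" if "A \<in> sigma_sets (space M) G" for A
    using G(1) GP that
  proof (induction rule: sigma_sets_induct_disjoint)
    case (basic A) then show ?case by (rule base)
  next
    case empty
    have "P (\<lambda>\<omega>. 0 * indicator (space M) \<omega>)"
      by (rule cmult[OF integrable_indicator_event[OF sets.top] base[OF G(3)]])
    moreover have "(\<lambda>\<omega>. 0 * indicator (space M) \<omega>) = (indicator {} :: 'a \<Rightarrow> real)" by auto
    ultimately show ?case by simp
  next
    case (compl A)
    note A = sigG[OF compl(1)]
    have "P (\<lambda>\<omega>. indicator (space M) \<omega> + (-1) * indicator A \<omega>)"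
      by (intro add cmult base[OF G(3)] compl integrable_indicator_event sets.top A
          Bochner_Integration.integrable_mult_right)
    then show ?case
    proof (rule AEP)
      show "AE \<omega> in M. indicator (space M) \<omega> + (-1) * indicator A \<omega>
          = (indicator (space M - A) \<omega> :: real)"
        by (rule AE_I2) (simp split: split_indicator)
    qed (intro integrable_indicator_event sets.Diff sets.top A Bochner_Integration.integrable_add
        Bochner_Integration.integrable_mult_right)+
  next
    case (union A)
    have A: "A i \<in> sets M" for i using union(2) sigG by auto
    have fin: "P (\<lambda>\<omega>. \<Sum>i<n. indicator (A i) \<omega>)" for n
    proof (induction n)
      case 0
      have "P (\<lambda>\<omega>. 0 * indicator (space M) \<omega>)"
        by (rule cmult[OF integrable_indicator_event[OF sets.top] base[OF G(3)]])
      then show ?case by simp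
    next
      case (Suc n)
      have "P (\<lambda>\<omega>. (\<Sum>i<n. indicator (A i) \<omega>) + indicator (A n) \<omega>)"
        by (intro add Suc union integrable_indicator_event A Bochner_Integration.integrable_sum)
      then show ?case by simp
    qed
    show ?case
    proof (rule lim[OF _ _ fin l1_dominated_convergence[where w="\<lambda>_. 1"]])
      show sum: "integrable M (\<lambda>\<omega>. \<Sum>i<n. indicator (A i) \<omega> :: real)" for n
        by (intro integrable_indicator_event A Bochner_Integration.integrable_sum)
      show sum': "integrable M (\<lambda>\<omega>. \<Sum>i<n. indicator (A i) \<omega> :: real)" for n
        by (rule sum)
      show un: "integrable M (indicator (\<Union>(range A)) :: 'a \<Rightarrow> real)"
        by (rule integrable_indicator_event) (use A in auto)
      show "integrable M (indicator (\<Union>(range A)) :: 'a \<Rightarrow> real)"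
        by (rule un)
      have "(\<lambda>i. indicator (A i) \<omega>) sums (indicator (\<Union>(range A)) \<omega> :: real)" for \<omega>
        by (rule indicator_sums) (use union(1) in \<open>auto simp: disjoint_family_on_def\<close>)
      then show "(\<lambda>n. \<Sum>i<n. indicator (A i) \<omega>) \<longlonglongrightarrow> (indicator (\<Union>(range A)) \<omega> :: real)" for \<omega>
        by (simp add: sums_def)
      have "(\<Sum>i<n. indicator (A i) \<omega>) = (indicator (\<Union>i<n. A i) \<omega> :: real)" for n \<omega>
        by (rule indicator_UN_disjoint[symmetric])
          (use union(1) in \<open>auto simp: disjoint_family_on_def\<close>)
      then show "\<bar>\<Sum>i<n. indicator (A i) \<omega>\<bar> \<le> (1 :: real)" for n \<omega>
        by (simp add: indicator_le_1)
    qed simp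
  qed
  have f': "integrable (restr_to_subalg M (fld G)) f"
    by (rule integrable_in_subalg[OF sub]) (use f in auto)
  have int: "integrable M g" if "integrable (restr_to_subalg M (fld G)) g" for g :: "'a \<Rightarrow> real"
    by (rule integrable_from_subalg[OF sub that])
  show ?thesis
    using f'
  proof (induction rule: integrable_induct)
    case (base A c)
    then have A: "A \<in> sigma_sets (space M) G"
      using GP by (simp add: sets_restr_to_subalg[OF sub])
    have "P (\<lambda>\<omega>. c * indicator A \<omega>)"
      by (rule cmult[OF integrable_indicator_event[OF sigG[OF A]] ind[OF A]])
    then show ?case by (simp add: mult.commute)
  next
    case (add f g) then show ?case using assms(7) int by auto
  next
    case (lim f s)
    show ?case
    proof (rule assms(9)[OF _ _ lim.IH l1_dominated_convergence[where w="\<lambda>\<omega>. 2 * \<bar>f \<omega>\<bar>"]])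
      show "(\<lambda>n. s n \<omega>) \<longlonglongrightarrow> f \<omega>" "\<bar>s n \<omega>\<bar> \<le> 2 * \<bar>f \<omega>\<bar>" if "\<omega> \<in> space M" for n \<omega>
        using lim.hyps(2)[of \<omega>] lim.hyps(3)[of \<omega> n] that by (simp_all add: space_restr_to_subalg)
    qed (use lim.hyps(1,4) int in auto)
  qed
qed

section \<open>Convergence of sigma-fields\<close>
definition sf_tendsto :: "(nat \<Rightarrow> 'a set set) \<Rightarrow> 'a set set \<Rightarrow> bool" where
  "sf_tendsto X x \<longleftrightarrow> (\<forall>f. integrable M f \<longrightarrow> (\<lambda>n. l1 (cexp (X n) f) (cexp x f)) \<longlonglongrightarrow> 0)"

text \<open>
  Conditional expectations are contractions, so the functions on which they converge form a closed
  set.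
\<close>
lemma cexp_tendsto_l1_closed:
  assumes X: "\<And>n. X n \<in> sigma_fields M" and x: "x \<in> sigma_fields M"
    and f: "integrable M f"
    and approx: "\<And>e. e > 0 \<Longrightarrow> \<exists>g. integrable M g \<and> l1 g f < e \<and>
      (\<lambda>n. l1 (cexp (X n) g) (cexp x g)) \<longlonglongrightarrow> 0"
  shows "(\<lambda>n. l1 (cexp (X n) f) (cexp x f)) \<longlonglongrightarrow> 0"
proof (rule LIMSEQ_I)
  fix e :: real assume e: "e > 0"
  obtain g where g: "integrable M g" "l1 g f < e / 3"
    "(\<lambda>n. l1 (cexp (X n) g) (cexp x g)) \<longlonglongrightarrow> 0"
    using approx[of "e / 3"] e by auto
  from LIMSEQ_D[OF g(3), of "e / 3"] e obtain N where
    N: "\<And>n. n \<ge> N \<Longrightarrow> l1 (cexp (X n) g) (cexp x g) < e / 3" by auto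
  have "norm (l1 (cexp (X n) f) (cexp x f) - 0) < e" if "n \<ge> N" for n
  proof -
    note int = cexp_integrable[OF X[of n] f] cexp_integrable[OF X[of n] g(1)]
      cexp_integrable[OF x f] cexp_integrable[OF x g(1)]
    have "l1 (cexp (X n) f) (cexp x f) \<le> l1 (cexp (X n) f) (cexp (X n) g) + l1 (cexp (X n) g) (cexp x f)"
      using int by (intro l1_triangle)
    also have "l1 (cexp (X n) g) (cexp x f) \<le> l1 (cexp (X n) g) (cexp x g) + l1 (cexp x g) (cexp x f)"
      using int by (intro l1_triangle)
    finally show ?thesis
      using cexp_l1_contraction[OF X[of n] f g(1)] cexp_l1_contraction[OF x g(1) f] g(2) N[OF that]
        l1_commute[of f g] by simp
  qed
  then show "\<exists>N. \<forall>n\<ge>N. norm (l1 (cexp (X n) f) (cexp x f) - 0) < e" by blast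
qed

lemma cexp_tendsto_generator:
  assumes X: "\<And>n. X n \<in> sigma_fields M" and x: "x \<in> sigma_fields M"
    and G: "Int_stable G" "G \<subseteq> sets M" "space M \<in> G"
    and f: "integrable M f" "f \<in> borel_measurable (fld G)"
    and base: "\<And>A. A \<in> G \<Longrightarrow>
      (\<lambda>n. l1 (cexp (X n) (indicator A)) (cexp x (indicator A))) \<longlonglongrightarrow> 0"
  shows "(\<lambda>n. l1 (cexp (X n) f) (cexp x f)) \<longlonglongrightarrow> 0"
  using G f base
proof (rule l1_class_induct[where P="\<lambda>f. (\<lambda>n. l1 (cexp (X n) f) (cexp x f)) \<longlonglongrightarrow> 0"])
  fix f g :: "'a \<Rightarrow> real"
  assume f: "integrable M f" and g: "integrable M g"
    and lf: "(\<lambda>n. l1 (cexp (X n) f) (cexp x f)) \<longlonglongrightarrow> 0"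
    and lg: "(\<lambda>n. l1 (cexp (X n) g) (cexp x g)) \<longlonglongrightarrow> 0"
  show "(\<lambda>n. l1 (cexp (X n) (\<lambda>\<omega>. f \<omega> + g \<omega>)) (cexp x (\<lambda>\<omega>. f \<omega> + g \<omega>))) \<longlonglongrightarrow> 0"
  proof (rule tendsto_sandwich[OF _ _ tendsto_const])
    show "(\<lambda>n. l1 (cexp (X n) f) (cexp x f) + l1 (cexp (X n) g) (cexp x g)) \<longlonglongrightarrow> 0"
      using tendsto_add[OF lf lg] by simp
    have "l1 (cexp (X n) (\<lambda>\<omega>. f \<omega> + g \<omega>)) (cexp x (\<lambda>\<omega>. f \<omega> + g \<omega>))
        \<le> l1 (cexp (X n) f) (cexp x f) + l1 (cexp (X n) g) (cexp x g)" for n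
    proof -
      note int = cexp_integrable[OF X[of n] f] cexp_integrable[OF X[of n] g]
        cexp_integrable[OF x f] cexp_integrable[OF x g]
        cexp_integrable[OF x Bochner_Integration.integrable_add[OF f g]]
        cexp_integrable[OF X[of n] Bochner_Integration.integrable_add[OF f g]]
      have "l1 (cexp (X n) (\<lambda>\<omega>. f \<omega> + g \<omega>)) (cexp x (\<lambda>\<omega>. f \<omega> + g \<omega>))
          = l1 (\<lambda>\<omega>. cexp (X n) f \<omega> + cexp (X n) g \<omega>) (\<lambda>\<omega>. cexp x f \<omega> + cexp x g \<omega>)"
        using int by (intro l1_cong_AE cexp_add X x f g) auto
      also have "\<dots> \<le> (\<integral>\<omega>. \<bar>cexp (X n) f \<omega> - cexp x f \<omega>\<bar> + \<bar>cexp (X n) g \<omega> - cexp x g \<omega>\<bar> \<partial>M)"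
        unfolding l1_def by (rule integral_mono) (use int in auto)
      also have "\<dots> = l1 (cexp (X n) f) (cexp x f) + l1 (cexp (X n) g) (cexp x g)"
        unfolding l1_def by (rule Bochner_Integration.integral_add) (use int in auto)
      finally show ?thesis .
    qed
    then show "\<forall>\<^sub>F n in sequentially. l1 (cexp (X n) (\<lambda>\<omega>. f \<omega> + g \<omega>)) (cexp x (\<lambda>\<omega>. f \<omega> + g \<omega>))
      \<le> l1 (cexp (X n) f) (cexp x f) + l1 (cexp (X n) g) (cexp x g)" by simp
  qed auto
next
  fix c :: real and f :: "'a \<Rightarrow> real"
  assume f: "integrable M f" and lf: "(\<lambda>n. l1 (cexp (X n) f) (cexp x f)) \<longlonglongrightarrow> 0"
  have "l1 (cexp (X n) (\<lambda>\<omega>. c * f \<omega>)) (cexp x (\<lambda>\<omega>. c * f \<omega>)) = \<bar>c\<bar> * l1 (cexp (X n) f) (cexp x f)" for n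
  proof -
    have "l1 (cexp (X n) (\<lambda>\<omega>. c * f \<omega>)) (cexp x (\<lambda>\<omega>. c * f \<omega>))
        = l1 (\<lambda>\<omega>. c * cexp (X n) f \<omega>) (\<lambda>\<omega>. c * cexp x f \<omega>)"
      using f X x by (intro l1_cong_AE cexp_cmult) (auto intro: cexp_integrable)
    then show ?thesis by (simp add: l1_def right_diff_distrib[symmetric] abs_mult)
  qed
  then show "(\<lambda>n. l1 (cexp (X n) (\<lambda>\<omega>. c * f \<omega>)) (cexp x (\<lambda>\<omega>. c * f \<omega>))) \<longlonglongrightarrow> 0"
    using tendsto_mult_left[OF lf, of "\<bar>c\<bar>"] by simp
next
  fix f :: "'a \<Rightarrow> real" and s
  assume f: "integrable M f" and s: "\<And>k. integrable M (s k)"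
    and ls: "\<And>k. (\<lambda>n. l1 (cexp (X n) (s k)) (cexp x (s k))) \<longlonglongrightarrow> 0"
    and l: "(\<lambda>k. l1 (s k) f) \<longlonglongrightarrow> 0"
  show "(\<lambda>n. l1 (cexp (X n) f) (cexp x f)) \<longlonglongrightarrow> 0"
  proof (rule cexp_tendsto_l1_closed[OF X x f])
    fix e :: real assume "e > 0"
    with LIMSEQ_D[OF l] obtain k where "l1 (s k) f < e" by force
    then show "\<exists>g. integrable M g \<and> l1 g f < e \<and> (\<lambda>n. l1 (cexp (X n) g) (cexp x g)) \<longlonglongrightarrow> 0"
      using s ls by blast
  qed
qed auto

lemma measurable_fld_sets: "borel_measurable (fld (sets M)) = borel_measurable M"
  by (rule measurable_cong_sets[OF sets.sets_measure_of_eq refl])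

lemma sf_tendstoI:
  assumes X: "\<And>n. X n \<in> sigma_fields M" and x: "x \<in> sigma_fields M"
    and base: "\<And>A. A \<in> sets M \<Longrightarrow>
      (\<lambda>n. l1 (cexp (X n) (indicator A)) (cexp x (indicator A))) \<longlonglongrightarrow> 0"
  shows "sf_tendsto X x"
  unfolding sf_tendsto_def
proof (intro allI impI)
  fix f :: "'a \<Rightarrow> real" assume f: "integrable M f"
  then have "f \<in> borel_measurable (fld (sets M))"
    unfolding measurable_fld_sets by (rule borel_measurable_integrable)
  then show "(\<lambda>n. l1 (cexp (X n) f) (cexp x f)) \<longlonglongrightarrow> 0"
    using base by (rule cexp_tendsto_generator[OF X x sets.Int_stable order_refl sets.top f])
qed

section \<open>Limits of monotone sequences\<close>
lemma cexp_indicator_bounds: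
  assumes x: "x \<in> sigma_fields M" and A: "A \<in> sets M"
  shows "AE \<omega> in M. 0 \<le> cexp x (indicator A) \<omega> \<and> cexp x (indicator A) \<omega> \<le> 1"
proof -
  interpret sigma_finite_subalgebra M "fld x" by (rule sigma_finite_subalgebra_fld[OF x])
  have "AE \<omega> in M. 0 \<le> cexp x (indicator A) \<omega>"
    unfolding cexp_def by (rule real_cond_exp_ge_c) (use A in auto)
  moreover have "AE \<omega> in M. cexp x (indicator A) \<omega> \<le> 1"
    unfolding cexp_def by (rule real_cond_exp_le_c) (use A in \<open>auto split: split_indicator\<close>)
  ultimately show ?thesis by auto
qed

text \<open>
  Completeness of the mean distance, in the bounded case that is used for conditional probabilities:
  a subsequence converges almost everywhere, and the bound makes this convergence dominated.
\<close>
lemma l1_complete_bounded: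
  fixes s :: "nat \<Rightarrow> 'a \<Rightarrow> real"
  assumes s: "\<And>n. integrable M (s n)" and bd: "\<And>n. AE \<omega> in M. \<bar>s n \<omega>\<bar> \<le> 1"
    and cauchy: "\<And>e. e > 0 \<Longrightarrow> \<exists>N. \<forall>i\<ge>N. \<forall>j\<ge>N. l1 (s i) (s j) < e"
  obtains g where "integrable M g" "(\<lambda>n. l1 (s n) g) \<longlonglongrightarrow> 0"
proof -
  obtain r where r: "strict_mono r" "AE \<omega> in M. Cauchy (\<lambda>i. s (r i) \<omega>)"
  proof (rule cauchy_L1_AE_cauchy_subseq[of M s])
    fix e :: real assume "e > 0"
    with cauchy[of e] show "\<exists>N. \<forall>i\<ge>N. \<forall>j\<ge>N. (LINT \<omega>|M. norm (s i \<omega> - s j \<omega>)) < e"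
      by (simp add: l1_def)
  qed (use s in auto)
  define g where "g = (\<lambda>\<omega>. lim (\<lambda>i. s (r i) \<omega>))"
  have g_meas[measurable]: "g \<in> borel_measurable M"
    unfolding g_def by (rule borel_measurable_lim_metric) (use s in auto)
  have lim: "AE \<omega> in M. (\<lambda>i. s (r i) \<omega>) \<longlonglongrightarrow> g \<omega>"
    using r(2) unfolding g_def by eventually_elim (simp add: Cauchy_convergent_iff convergent_LIMSEQ_iff)
  have bd': "AE \<omega> in M. \<forall>n. \<bar>s n \<omega>\<bar> \<le> 1" using bd by (simp add: AE_all_countable)
  have "AE \<omega> in M. \<bar>g \<omega>\<bar> \<le> 1"
    using lim bd'
  proof eventually_elim
    case (elim \<omega>)
    have "(\<lambda>i. \<bar>s (r i) \<omega>\<bar>) \<longlonglongrightarrow> \<bar>g \<omega>\<bar>" using elim by (intro tendsto_intros)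
    then show ?case by (rule LIMSEQ_le_const2) (use elim in auto)
  qed
  then have gint: "integrable M g" by (intro integrable_const_bound[of _ 1]) auto
  have "(\<lambda>i. \<integral>\<omega>. \<bar>s (r i) \<omega> - g \<omega>\<bar> \<partial>M) \<longlonglongrightarrow> (\<integral>\<omega>. 0 \<partial>M)"
  proof (rule integral_dominated_convergence[where w="\<lambda>\<omega>. 1 + \<bar>g \<omega>\<bar>"])
    show "AE \<omega> in M. (\<lambda>i. \<bar>s (r i) \<omega> - g \<omega>\<bar>) \<longlonglongrightarrow> 0"
      using lim
    proof eventually_elim
      case (elim \<omega>)
      have "(\<lambda>i. \<bar>s (r i) \<omega> - g \<omega>\<bar>) \<longlonglongrightarrow> \<bar>g \<omega> - g \<omega>\<bar>" by (intro tendsto_intros elim)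
      then show ?case by simp
    qed
    show "AE \<omega> in M. norm \<bar>s (r i) \<omega> - g \<omega>\<bar> \<le> 1 + \<bar>g \<omega>\<bar>" for i
      using bd[of "r i"] by eventually_elim auto
  qed (use s gint borel_measurable_integrable in auto)
  then have sub: "(\<lambda>i. l1 (s (r i)) g) \<longlonglongrightarrow> 0" by (simp add: l1_def)
  have "(\<lambda>n. l1 (s n) g) \<longlonglongrightarrow> 0"
  proof (rule LIMSEQ_I)
    fix e :: real assume e: "e > 0"
    obtain N where N: "\<And>i j. i \<ge> N \<Longrightarrow> j \<ge> N \<Longrightarrow> l1 (s i) (s j) < e / 2"
      using cauchy[of "e / 2"] e by auto
    obtain K where K: "\<And>k. k \<ge> K \<Longrightarrow> l1 (s (r k)) g < e / 2"
      using LIMSEQ_D[OF sub, of "e / 2"] e by auto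
    have "norm (l1 (s n) g - 0) < e" if "n \<ge> N" for n
    proof -
      have "r (max N K) \<ge> N" using seq_suble[OF r(1), of "max N K"] by simp
      then have "l1 (s n) (s (r (max N K))) < e / 2" using N that by auto
      moreover have "l1 (s (r (max N K))) g < e / 2" using K by auto
      ultimately show ?thesis
        using l1_triangle[of "s n" "s (r (max N K))" g] s gint by auto
    qed
    then show "\<exists>N. \<forall>n\<ge>N. norm (l1 (s n) g - 0) < e" by blast
  qed
  with gint show ?thesis by (rule that)
qed

lemma integrable_bounded_mult:
  assumes "integrable M f" "k \<in> borel_measurable M" "AE \<omega> in M. \<bar>k \<omega>\<bar> \<le> (1::real)"
  shows "integrable M (\<lambda>\<omega>. f \<omega> * k \<omega>)"
proof (rule Bochner_Integration.integrable_bound[OF assms(1)])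
  show "AE \<omega> in M. norm (f \<omega> * k \<omega>) \<le> norm (f \<omega>)"
    using assms(3) by eventually_elim (simp add: abs_mult mult_left_le)
qed (use assms in auto)

lemma integral_mult_cexp:
  assumes x: "x \<in> sigma_fields M" and f: "f \<in> borel_measurable (fld x)"
    and g: "g \<in> borel_measurable M" and fg: "integrable M (\<lambda>\<omega>. f \<omega> * g \<omega>)"
  shows "(\<integral>\<omega>. f \<omega> * cexp x g \<omega> \<partial>M) = (\<integral>\<omega>. f \<omega> * g \<omega> \<partial>M)"
  unfolding cexp_def
  by (rule sigma_finite_subalgebra.real_cond_exp_intg(2)[OF sigma_finite_subalgebra_fld[OF x]]) fact+

text \<open>
  Comparison with the quadratic mean, as nonnegativity of the variance.
\<close>
lemma l1_square_le:
  assumes "integrable M f" "integrable M g" "integrable M (\<lambda>\<omega>. (f \<omega> - g \<omega>)\<^sup>2)"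
  shows "(l1 f g)\<^sup>2 \<le> (\<integral>\<omega>. (f \<omega> - g \<omega>)\<^sup>2 \<partial>M)"
proof -
  have "0 \<le> variance (\<lambda>\<omega>. \<bar>f \<omega> - g \<omega>\<bar>)" by (rule variance_positive)
  also have "\<dots> = expectation (\<lambda>\<omega>. \<bar>f \<omega> - g \<omega>\<bar>\<^sup>2) - (expectation (\<lambda>\<omega>. \<bar>f \<omega> - g \<omega>\<bar>))\<^sup>2"
    by (rule variance_eq) (use assms in auto)
  finally show ?thesis by (simp add: l1_def)
qed

text \<open>
  For a decreasing sequence, the conditional probabilities \<open>s n\<close> satisfy the theorem of Pythagoras:
  the squared distance of \<open>s m\<close> and \<open>s n\<close> is the difference of their squared norms. These norms decrease
  and hence converge, so that \<open>s\<close> is a Cauchy sequence.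
\<close>
lemma decreasing_cexp_converges:
  assumes X: "\<And>n. X n \<in> sigma_fields M" and dec: "\<And>m n. m \<le> n \<Longrightarrow> X n \<subseteq> X m"
    and A: "A \<in> sets M"
  obtains g where "integrable M g" "(\<lambda>n. l1 (cexp (X n) (indicator A)) g) \<longlonglongrightarrow> 0"
proof -
  define s where "s n = cexp (X n) (indicator A)" for n
  have s: "integrable M (s n)" for n
    unfolding s_def by (rule cexp_integrable[OF X]) (use A in auto)
  have bd: "AE \<omega> in M. \<bar>s n \<omega>\<bar> \<le> 1" for n
    using cexp_indicator_bounds[OF X A, of n] unfolding s_def by eventually_elim auto
  have prod: "integrable M (\<lambda>\<omega>. s m \<omega> * s n \<omega>)" for m n
    by (rule integrable_bounded_mult[OF s _ bd]) (use s in auto)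
  have proj: "(\<integral>\<omega>. s n \<omega> * s m \<omega> \<partial>M) = (\<integral>\<omega>. s n \<omega> * s n \<omega> \<partial>M)" if "m \<le> n" for m n
  proof -
    have ae: "AE \<omega> in M. cexp (X n) (s m) \<omega> = s n \<omega>"
      unfolding s_def by (rule cexp_tower[OF X X dec[OF that]]) (use A in auto)
    have "(\<integral>\<omega>. s n \<omega> * s m \<omega> \<partial>M) = (\<integral>\<omega>. s n \<omega> * cexp (X n) (s m) \<omega> \<partial>M)"
      by (rule integral_mult_cexp[OF X, symmetric]) (use prod s in \<open>auto simp: s_def\<close>)
    also have "\<dots> = (\<integral>\<omega>. s n \<omega> * s n \<omega> \<partial>M)"
      by (rule integral_cong_AE)
        (use ae s cexp_integrable[OF X s] in \<open>auto intro!: borel_measurable_times\<close>)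
    finally show ?thesis .
  qed
  define S where "S n = (\<integral>\<omega>. s n \<omega> * s n \<omega> \<partial>M)" for n
  have sq: "integrable M (\<lambda>\<omega>. (s m \<omega> - s n \<omega>)\<^sup>2)" for m n
    using prod by (simp add: power2_eq_square algebra_simps)
  have pyth: "(\<integral>\<omega>. (s m \<omega> - s n \<omega>)\<^sup>2 \<partial>M) = S m - S n" if "m \<le> n" for m n
  proof -
    have "(\<integral>\<omega>. (s m \<omega> - s n \<omega>)\<^sup>2 \<partial>M)
        = (\<integral>\<omega>. (s m \<omega> * s m \<omega> - 2 * (s n \<omega> * s m \<omega>)) + s n \<omega> * s n \<omega> \<partial>M)"
      by (intro Bochner_Integration.integral_cong) (auto simp: power2_eq_square algebra_simps)
    also have "\<dots> = S m - 2 * (\<integral>\<omega>. s n \<omega> * s m \<omega> \<partial>M) + S n"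
      using prod by (simp add: S_def)
    finally show ?thesis using proj[OF that] by (simp add: S_def)
  qed
  have "decseq S"
  proof (rule decseq_SucI)
    fix n
    have "0 \<le> (\<integral>\<omega>. (s n \<omega> - s (Suc n) \<omega>)\<^sup>2 \<partial>M)" by simp
    then show "S (Suc n) \<le> S n" using pyth[of n "Suc n"] by simp
  qed
  then obtain L where L: "S \<longlonglongrightarrow> L" "\<And>n. L \<le> S n"
    using decseq_convergent[of S 0] by (auto simp: S_def)
  have cauchy: "\<exists>N. \<forall>i\<ge>N. \<forall>j\<ge>N. l1 (s i) (s j) < e" if e: "e > 0" for e
  proof -
    obtain N where N: "\<And>n. n \<ge> N \<Longrightarrow> \<bar>S n - L\<bar> < e\<^sup>2"
      using LIMSEQ_D[OF L(1), of "e\<^sup>2"] e by auto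
    have *: "l1 (s i) (s j) < e" if "i \<ge> N" "i \<le> j" for i j
    proof -
      have "(l1 (s i) (s j))\<^sup>2 \<le> S i - S j"
        using l1_square_le[OF s s sq, of i j] pyth[OF that(2)] by simp
      also have "\<dots> < e\<^sup>2" using N[OF that(1)] L(2)[of j] by simp
      finally show ?thesis using e by (simp add: power_less_imp_less_base)
    qed
    have "l1 (s i) (s j) < e" if "i \<ge> N" "j \<ge> N" for i j
      using *[of i j] *[of j i] that l1_commute[of "s i" "s j"] by (cases "i \<le> j") auto
    then show ?thesis by blast
  qed
  obtain g where "integrable M g" "(\<lambda>n. l1 (s n) g) \<longlonglongrightarrow> 0"
    using l1_complete_bounded[OF s bd cauchy] by blast
  then show ?thesis by (intro that[of g]) (simp_all add: s_def)
qed

lemma INT_sigma_fields: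
  assumes "I \<noteq> {}" "\<And>i. i \<in> I \<Longrightarrow> X i \<in> sigma_fields M"
  shows "(\<Inter>i\<in>I. X i) \<in> sigma_fields M"
proof -
  have "sigma_algebra (space M) (\<Inter>i\<in>I. X i)"
    unfolding sigma_algebra_iff2
  proof (intro conjI ballI allI impI)
    have sa: "sigma_algebra (space M) (X i)" if "i \<in> I" for i
      using assms(2)[OF that] by (simp add: sigma_fields_def)
    note * = sa[unfolded sigma_algebra_iff2]
    show "(\<Inter>i\<in>I. X i) \<subseteq> Pow (space M)" using * assms(1) by blast
    show "{} \<in> (\<Inter>i\<in>I. X i)" using * by blast
    show "space M - s \<in> (\<Inter>i\<in>I. X i)" if "s \<in> (\<Inter>i\<in>I. X i)" for s using * that by blast
    show "\<Union>(range A) \<in> (\<Inter>i\<in>I. X i)" if "range A \<subseteq> (\<Inter>i\<in>I. X i)" for A :: "nat \<Rightarrow> _"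
      using * that by (simp add: le_INF_iff)
  qed
  then show ?thesis using assms by (auto simp: sigma_fields_def)
qed

lemma Int_sigma_fields:
  assumes "x \<in> sigma_fields M" "y \<in> sigma_fields M"
  shows "x \<inter> y \<in> sigma_fields M"
proof -
  have "(\<Inter>z\<in>{x, y}. z) \<in> sigma_fields M" by (rule INT_sigma_fields) (use assms in auto)
  then show ?thesis by simp
qed

lemma measurable_fld_INT:
  assumes "I \<noteq> {}" "\<And>i. i \<in> I \<Longrightarrow> X i \<in> sigma_fields M"
    and "\<And>i. i \<in> I \<Longrightarrow> f \<in> borel_measurable (fld (X i))"
  shows "f \<in> borel_measurable (fld (\<Inter>i\<in>I. X i))"
  using assms(3) unfolding measurable_def
  by (auto simp: sets_fld[OF assms(2)] sets_fld[OF INT_sigma_fields[OF assms(1,2)]] space_fld)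

lemma measurable_fld_Int:
  assumes "x \<in> sigma_fields M" "y \<in> sigma_fields M"
    "f \<in> borel_measurable (fld x)" "f \<in> borel_measurable (fld y)"
  shows "f \<in> borel_measurable (fld (x \<inter> y))"
proof -
  have "f \<in> borel_measurable (fld (\<Inter>z\<in>{x, y}. z))"
    by (rule measurable_fld_INT) (use assms in auto)
  then show ?thesis by simp
qed

text \<open>
  The limit of the conditional expectations is measurable for every \<open>X m\<close>, hence for their
  intersection, and the conditional expectation on the intersection is the same along the sequence.
\<close>
lemma sf_tendsto_decreasing:
  assumes X: "\<And>n. X n \<in> sigma_fields M" and dec: "\<And>m n. m \<le> n \<Longrightarrow> X n \<subseteq> X m"
  shows "sf_tendsto X (\<Inter>n. X n)"
proof (rule sf_tendstoI[OF X])
  define x where "x = (\<Inter>n. X n)"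
  have x: "x \<in> sigma_fields M" unfolding x_def by (rule INT_sigma_fields) (use X in auto)
  then show "(\<Inter>n. X n) \<in> sigma_fields M" by (simp add: x_def)
  fix A assume A: "A \<in> sets M"
  let ?s = "\<lambda>n. cexp (X n) (indicator A)"
  have f: "integrable M (indicator A :: 'a \<Rightarrow> real)" using A by auto
  obtain g where g: "integrable M g" "(\<lambda>n. l1 (?s n) g) \<longlonglongrightarrow> 0"
    by (rule decreasing_cexp_converges[OF X dec A])
  note int = cexp_integrable[OF X f] cexp_integrable[OF x f] cexp_integrable[OF x g(1)]
  have "g \<in> borel_measurable (fld (X m))" for m
  proof (rule measurable_fld_l1_closed[OF X g(1), of "\<lambda>n. ?s (n + m)"])
    show "?s (n + m) \<in> borel_measurable (fld (X m))" for n
      by (rule measurable_fld_mono[OF dec X X cexp_measurable]) simp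
    show "(\<lambda>n. l1 (?s (n + m)) g) \<longlonglongrightarrow> 0" by (rule LIMSEQ_ignore_initial_segment[OF g(2)])
  qed (use int in auto)
  then have "g \<in> borel_measurable (fld x)"
    unfolding x_def by (intro measurable_fld_INT X) auto
  then have gx: "AE \<omega> in M. cexp x g \<omega> = g \<omega>" by (rule cexp_fixes[OF x g(1)])
  have "l1 (cexp x (indicator A)) (cexp x g) \<le> l1 (?s n) g" for n
  proof -
    have "AE \<omega> in M. cexp x (?s n) \<omega> = cexp x (indicator A) \<omega>"
      by (rule cexp_tower[OF x X _ f]) (auto simp: x_def)
    then have "l1 (cexp x (indicator A)) (cexp x g) = l1 (cexp x (?s n)) (cexp x g)"
      using int cexp_integrable[OF x int(1)] by (intro l1_cong_AE) auto
    also have "\<dots> \<le> l1 (?s n) g" by (rule cexp_l1_contraction[OF x int(1) g(1)])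
    finally show ?thesis .
  qed
  then have "l1 (cexp x (indicator A)) (cexp x g) \<le> 0"
    by (intro LIMSEQ_le_const[OF g(2)]) auto
  then have "AE \<omega> in M. cexp x (indicator A) \<omega> = cexp x g \<omega>"
    by (rule l1_eq_0_AE[OF int(2,3)])
  with gx have "AE \<omega> in M. g \<omega> = cexp x (indicator A) \<omega>" by eventually_elim simp
  then have "l1 (?s n) g = l1 (?s n) (cexp x (indicator A))" for n
    using int g by (intro l1_cong_AE) auto
  with g(2) show "(\<lambda>n. l1 (?s n) (cexp (\<Inter>n. X n) (indicator A))) \<longlonglongrightarrow> 0"
    by (simp add: x_def)
qed

text \<open>
  On an event of \<open>X N\<close> the sequence is constant from \<open>N\<close> on, and these events form a pi-system that
  generates the supremum. A general function is first replaced by its conditional expectation on the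
  supremum, which changes neither side.
\<close>
lemma sf_tendsto_increasing:
  assumes X: "\<And>n. X n \<in> sigma_fields M" and inc: "\<And>m n. m \<le> n \<Longrightarrow> X m \<subseteq> X n"
  shows "sf_tendsto X (sup_field M (range X))"
  unfolding sf_tendsto_def
proof (intro allI impI)
  fix f :: "'a \<Rightarrow> real" assume f: "integrable M f"
  define x where "x = sup_field M (range X)"
  have x: "x \<in> sigma_fields M"
    unfolding x_def by (rule sup_field_in_sigma_fields) (use X in auto)
  have Xx: "X n \<subseteq> x" for n unfolding x_def by (rule sup_field_upper) auto
  define G where "G = (\<Union>n. X n)"
  define g where "g = cexp x f"
  have g: "integrable M g" unfolding g_def by (rule cexp_integrable[OF x f])
  have GM: "G \<subseteq> sets M" using X by (auto simp: G_def sigma_fields_def)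
  have "null_sets M \<union> \<Union>(range X) = G" using X by (auto simp: G_def sigma_fields_def)
  then have sG: "sigma_sets (space M) G = x" by (simp add: x_def sup_field_def)
  have "(\<lambda>n. l1 (cexp (X n) g) (cexp x g)) \<longlonglongrightarrow> 0"
  proof (rule cexp_tendsto_generator[OF X x _ GM _ g])
    show "Int_stable G"
    proof (rule Int_stableI)
      fix A B assume "A \<in> G" "B \<in> G"
      then obtain m n where "A \<in> X m" "B \<in> X n" by (auto simp: G_def)
      then have "A \<in> X (max m n)" "B \<in> X (max m n)"
        using inc[of m "max m n"] inc[of n "max m n"] by auto
      then show "A \<inter> B \<in> G" using sigma_field_Int[OF X] by (auto simp: G_def)
    qed
    show "space M \<in> G" using sigma_field_space[OF X] by (auto simp: G_def)
    have "sets (fld G) = sets (fld x)"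
      using GM sets.space_closed[of M] by (subst sets_measure_of) (auto simp: sG sets_fld[OF x])
    then show "g \<in> borel_measurable (fld G)"
      using cexp_measurable[of x f] unfolding g_def by (simp cong: measurable_cong_sets)
    fix A assume AG: "A \<in> G"
    then obtain N where N: "A \<in> X N" by (auto simp: G_def)
    have A: "A \<in> sets M" using AG GM by auto
    then have Ai: "integrable M (indicator A :: 'a \<Rightarrow> real)" by auto
    have fix1: "AE \<omega> in M. cexp y (indicator A) \<omega> = indicator A \<omega>" if "A \<in> y" "y \<in> sigma_fields M" for y
      using that sets.sets_into_space[OF A]
      by (intro cexp_fixes Ai) (auto simp: indicator_measurable_fld_iff)
    have "l1 (cexp (X n) (indicator A)) (cexp x (indicator A)) = 0" if "n \<ge> N" for n
    proof -
      have "l1 (cexp (X n) (indicator A)) (cexp x (indicator A)) = l1 (indicator A) (indicator A)"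
        by (intro l1_cong_AE fix1 cexp_integrable X x Ai) (use N inc[OF that] Xx in auto)
      then show ?thesis by (simp add: l1_def)
    qed
    then show "(\<lambda>n. l1 (cexp (X n) (indicator A)) (cexp x (indicator A))) \<longlonglongrightarrow> 0"
      by (intro tendsto_eventually) (auto simp: eventually_sequentially)
  qed
  moreover have "l1 (cexp (X n) g) (cexp x g) = l1 (cexp (X n) f) (cexp x f)" for n
    unfolding g_def
    by (intro l1_cong_AE cexp_tower X x Xx f cexp_integrable order_refl)
  ultimately show "(\<lambda>n. l1 (cexp (X n) f) (cexp (sup_field M (range X)) f)) \<longlonglongrightarrow> 0"
    by (simp add: x_def)
qed

section \<open>Joins of independent sigma-fields\<close>
lemma trivial_field_least:
  assumes "x \<in> sigma_fields M"
  shows "trivial_field M \<subseteq> x"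
proof -
  interpret sigma_algebra "space M" x using assms by (simp add: sigma_fields_def)
  show ?thesis using assms by (auto simp: trivial_field_def sigma_fields_def)
qed

lemma trivial_field_in_sigma_fields: "trivial_field M \<in> sigma_fields M"
proof -
  have co_null: "A \<in> trivial_field M" if "A \<in> sets M" "space M - A \<in> null_sets M" for A
  proof -
    have "A = space M - (space M - A)" using sets.sets_into_space[OF that(1)] by auto
    then show ?thesis using that(2) unfolding trivial_field_def by blast
  qed
  have dich: "A \<in> null_sets M \<or> (A \<in> sets M \<and> space M - A \<in> null_sets M)"
    if "A \<in> trivial_field M" for A
  proof -
    have "space M - (space M - N) = N" if "N \<in> null_sets M" for N
      using sets.sets_into_space[OF null_setsD2[OF that]] by auto
    then show ?thesis using that by (auto simp: trivial_field_def)
  qed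
  have sub: "trivial_field M \<subseteq> sets M" using dich by auto
  have "sigma_algebra (space M) (trivial_field M)"
    unfolding sigma_algebra_iff2
  proof (intro conjI ballI allI impI)
    show "trivial_field M \<subseteq> Pow (space M)" using sub sets.sets_into_space by blast
    show "{} \<in> trivial_field M" by (auto simp: trivial_field_def)
    show "space M - A \<in> trivial_field M" if "A \<in> trivial_field M" for A
      using dich[OF that] by (auto simp: trivial_field_def)
    fix A :: "nat \<Rightarrow> 'a set" assume A: "range A \<subseteq> trivial_field M"
    then have UN: "\<Union>(range A) \<in> sets M" using sub by auto
    show "\<Union>(range A) \<in> trivial_field M"
    proof (cases "\<forall>i. A i \<in> null_sets M")
      case True
      then have "\<Union>(range A) \<in> null_sets M" by auto
      then show ?thesis by (simp add: trivial_field_def)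
    next
      case False
      then obtain i where i: "A i \<notin> null_sets M" by auto
      have "space M - A i \<in> null_sets M" using dich[of "A i"] i A by auto
      then have "space M - \<Union>(range A) \<in> null_sets M"
        by (rule null_sets_subset) (use UN in auto)
      then show ?thesis by (rule co_null[OF UN])
    qed
  qed
  with sub show ?thesis by (auto simp: sigma_fields_def trivial_field_def)
qed

lemma join_in_sigma_fields:
  assumes "x \<in> sigma_fields M" "y \<in> sigma_fields M"
  shows "join_field M x y \<in> sigma_fields M"
  unfolding join_field_def by (rule sup_field_in_sigma_fields) (use assms in auto)

lemma join_upper1: "x \<subseteq> join_field M x y" and join_upper2: "y \<subseteq> join_field M x y"
  unfolding join_field_def by (auto intro: sup_field_upper[THEN subsetD])

lemma join_least:
  assumes "z \<in> sigma_fields M" "x \<subseteq> z" "y \<subseteq> z"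
  shows "join_field M x y \<subseteq> z"
  unfolding join_field_def by (rule sup_field_least) (use assms in auto)

lemma join_commute: "join_field M x y = join_field M y x"
  by (simp add: join_field_def insert_commute)

text \<open>
  The pi-system that generates the join.
\<close>
definition rectangles :: "'a set set \<Rightarrow> 'a set set \<Rightarrow> 'a set set" where
  "rectangles u v = {A \<inter> B | A B. A \<in> u \<and> B \<in> v}"

lemma rectangles_pi_system:
  assumes u: "u \<in> sigma_fields M" and v: "v \<in> sigma_fields M"
  shows "Int_stable (rectangles u v)" "rectangles u v \<subseteq> sets M" "space M \<in> rectangles u v"
    and "borel_measurable (fld (rectangles u v)) = borel_measurable (fld (join_field M u v))"
proof -
  show "Int_stable (rectangles u v)"
  proof (rule Int_stableI)
    fix C D assume "C \<in> rectangles u v" "D \<in> rectangles u v"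
    then obtain A B A' B' where *: "C = A \<inter> B" "D = A' \<inter> B'" "A \<in> u" "A' \<in> u" "B \<in> v" "B' \<in> v"
      by (auto simp: rectangles_def)
    have "C \<inter> D = (A \<inter> A') \<inter> (B \<inter> B')" using * by auto
    moreover have "A \<inter> A' \<in> u" "B \<inter> B' \<in> v" using * sigma_field_Int u v by auto
    ultimately show "C \<inter> D \<in> rectangles u v" unfolding rectangles_def by blast
  qed
  show sub: "rectangles u v \<subseteq> sets M"
    using sigma_field_events u v by (auto simp: rectangles_def)
  have "space M = space M \<inter> space M" by simp
  then show "space M \<in> rectangles u v"
    using sigma_field_space[OF u] sigma_field_space[OF v] unfolding rectangles_def by blast
  have pow: "rectangles u v \<subseteq> Pow (space M)" using sub sets.sets_into_space by blast
  have uR: "u \<subseteq> rectangles u v"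
  proof
    fix A assume A: "A \<in> u"
    then have "A = A \<inter> space M" using sets.sets_into_space sigma_field_events[OF u] by blast
    then show "A \<in> rectangles u v" using A sigma_field_space[OF v] unfolding rectangles_def by blast
  qed
  have vR: "v \<subseteq> rectangles u v"
  proof
    fix B assume B: "B \<in> v"
    then have "B = space M \<inter> B" using sets.sets_into_space sigma_field_events[OF v] by blast
    then show "B \<in> rectangles u v" using B sigma_field_space[OF u] unfolding rectangles_def by blast
  qed
  have "sigma_sets (space M) (rectangles u v) = join_field M u v"
  proof
    have "sigma_algebra (space M) (join_field M u v)"
      using join_in_sigma_fields[OF u v] by (simp add: sigma_fields_def)
    moreover have "rectangles u v \<subseteq> join_field M u v"
      using sigma_field_Int[OF join_in_sigma_fields[OF u v]] join_upper1[of u v] join_upper2[of v u]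
      unfolding rectangles_def by blast
    ultimately show "sigma_sets (space M) (rectangles u v) \<subseteq> join_field M u v"
      by (rule sigma_algebra.sigma_sets_subset)
    have "null_sets M \<union> \<Union>{u, v} \<subseteq> rectangles u v"
      using uR vR u by (auto simp: sigma_fields_def)
    then show "join_field M u v \<subseteq> sigma_sets (space M) (rectangles u v)"
      unfolding join_field_def sup_field_def by (rule sigma_sets_mono')
  qed
  then have "sets (fld (rectangles u v)) = sets (fld (join_field M u v))"
    by (simp only: sets_fld[OF join_in_sigma_fields[OF u v]] sets_measure_of[OF pow])
  then show "borel_measurable (fld (rectangles u v)) = borel_measurable (fld (join_field M u v))"
    by (rule measurable_cong_sets[OF _ refl])
qed

lemma indep_set_fldD:
  assumes "indep_set y z" "A \<in> y" "B \<in> z"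
  shows "prob (A \<inter> B) = prob A * prob B"
  using assms by (simp add: indep_sets2_eq)

lemma indep_set_subset:
  assumes "indep_set y z" "u \<subseteq> y" "v \<subseteq> z"
  shows "indep_set u v"
  using assms unfolding indep_sets2_eq by blast

lemma indep_set_commute: "indep_set y z \<Longrightarrow> indep_set z y"
  unfolding indep_sets2_eq by (metis inf_commute mult.commute)

lemma integral_mult_indep:
  fixes f g :: "'a \<Rightarrow> real"
  assumes y: "y \<in> sigma_fields M" and z: "z \<in> sigma_fields M" and ind: "indep_set y z"
    and f: "integrable M f" "f \<in> borel_measurable (fld y)"
    and g: "integrable M g" "g \<in> borel_measurable (fld z)"
  shows "(\<integral>\<omega>. f \<omega> * g \<omega> \<partial>M) = (\<integral>\<omega>. f \<omega> \<partial>M) * (\<integral>\<omega>. g \<omega> \<partial>M)"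
proof -
  have pre: "sigma_sets (space M) {h -` A \<inter> space M |A. A \<in> sets borel} \<subseteq> x"
    if "x \<in> sigma_fields M" "h \<in> borel_measurable (fld x)" for x and h :: "'a \<Rightarrow> real"
  proof (rule sigma_algebra.sigma_sets_subset)
    show "sigma_algebra (space M) x" using that(1) by (simp add: sigma_fields_def)
    show "{h -` A \<inter> space M |A. A \<in> sets borel} \<subseteq> x"
      using measurable_sets[OF that(2)] by (auto simp: space_fld sets_fld[OF that(1)])
  qed
  have "indep_var borel f borel g"
    unfolding indep_var_eq
    using indep_set_subset[OF ind pre[OF y f(2)] pre[OF z g(2)]] f(1) g(1)
    by (auto intro: borel_measurable_integrable)
  then show ?thesis using f(1) g(1) by (rule indep_var_lebesgue_integral)
qed

lemma integral_bounded_mult_tendsto: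
  assumes s: "\<And>n. integrable M (s n)" and h: "integrable M h"
    and k: "k \<in> borel_measurable M" "AE \<omega> in M. \<bar>k \<omega>\<bar> \<le> (1::real)"
    and lim: "(\<lambda>n. l1 (s n) h) \<longlonglongrightarrow> 0"
  shows "(\<lambda>n. \<integral>\<omega>. s n \<omega> * k \<omega> \<partial>M) \<longlonglongrightarrow> (\<integral>\<omega>. h \<omega> * k \<omega> \<partial>M)"
proof (rule LIM_zero_cancel, rule tendsto_rabs_zero_cancel, rule tendsto_sandwich[OF _ _ tendsto_const lim])
  show "\<forall>\<^sub>F n in sequentially. \<bar>(\<integral>\<omega>. s n \<omega> * k \<omega> \<partial>M) - (\<integral>\<omega>. h \<omega> * k \<omega> \<partial>M)\<bar> \<le> l1 (s n) h"
  proof (rule always_eventually, rule allI)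
    fix n
    note int = integrable_bounded_mult[OF s[of n] k] integrable_bounded_mult[OF h k]
    have "(\<integral>\<omega>. s n \<omega> * k \<omega> \<partial>M) - (\<integral>\<omega>. h \<omega> * k \<omega> \<partial>M) = (\<integral>\<omega>. s n \<omega> * k \<omega> - h \<omega> * k \<omega> \<partial>M)"
      using int by simp
    also have "\<bar>\<dots>\<bar> \<le> (\<integral>\<omega>. \<bar>s n \<omega> * k \<omega> - h \<omega> * k \<omega>\<bar> \<partial>M)" by (rule integral_abs_bound)
    also have "\<dots> \<le> l1 (s n) h"
      unfolding l1_def
    proof (rule integral_mono_AE)
      show "AE \<omega> in M. \<bar>s n \<omega> * k \<omega> - h \<omega> * k \<omega>\<bar> \<le> \<bar>s n \<omega> - h \<omega>\<bar>"
        using k(2)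
      proof eventually_elim
        case (elim \<omega>)
        have "\<bar>s n \<omega> * k \<omega> - h \<omega> * k \<omega>\<bar> = \<bar>s n \<omega> - h \<omega>\<bar> * \<bar>k \<omega>\<bar>"
          by (simp add: left_diff_distrib[symmetric] abs_mult)
        then show ?case using mult_left_le[OF elim abs_ge_zero[of "s n \<omega> - h \<omega>"]] by simp
      qed
    qed (use int s h in auto)
    finally show "\<bar>(\<integral>\<omega>. s n \<omega> * k \<omega> \<partial>M) - (\<integral>\<omega>. h \<omega> * k \<omega> \<partial>M)\<bar> \<le> l1 (s n) h" .
  qed
qed simp

lemma cexp_indicator_abs_le_1:
  assumes "x \<in> sigma_fields M" "A \<in> sets M"
  shows "AE \<omega> in M. \<bar>cexp x (indicator A) \<omega>\<bar> \<le> 1"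
  using cexp_indicator_bounds[OF assms] by eventually_elim auto

lemma cexp_measurable_M: "x \<in> sigma_fields M \<Longrightarrow> cexp x f \<in> borel_measurable M"
  by (rule measurable_fld_M[OF _ cexp_measurable])

lemma cexp_indicator_fixes:
  assumes "x \<in> sigma_fields M" "A \<in> x"
  shows "AE \<omega> in M. cexp x (indicator A) \<omega> = indicator A \<omega>"
proof -
  have A: "A \<in> sets M" by (rule sigma_field_events[OF assms])
  show ?thesis
    by (rule cexp_fixes[OF assms(1)])
      (use A assms indicator_measurable_fld_iff[OF assms(1) sets.sets_into_space[OF A]] in auto)
qed

text \<open>
  Independence of \<open>y\<close> and \<open>z\<close> makes conditional expectation on a join a tensor product. Both sides
  have the same integral over \<open>A' \<inter> B'\<close> with \<open>A'\<close> in \<open>u\<close> and \<open>B'\<close> in \<open>v\<close>, since all integrals in question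
  are products of an integral belonging to \<open>y\<close> and one belonging to \<open>z\<close>.
\<close>
lemma cexp_join_indep:
  assumes y: "y \<in> sigma_fields M" and z: "z \<in> sigma_fields M" and ind: "indep_set y z"
    and u: "u \<in> sigma_fields M" "u \<subseteq> y" and v: "v \<in> sigma_fields M" "v \<subseteq> z"
    and A: "A \<in> y" and B: "B \<in> z"
  shows "AE \<omega> in M. cexp (join_field M u v) (indicator (A \<inter> B)) \<omega>
    = cexp u (indicator A) \<omega> * cexp v (indicator B) \<omega>"
proof -
  define w where "w = join_field M u v"
  have w: "w \<in> sigma_fields M" unfolding w_def by (rule join_in_sigma_fields[OF u(1) v(1)])
  have uw: "u \<subseteq> w" and vw: "v \<subseteq> w" unfolding w_def by (rule join_upper1 join_upper2)+
  have AM: "A \<in> sets M" and BM: "B \<in> sets M"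
    using sigma_field_events[OF y A] sigma_field_events[OF z B] by auto
  define a where "a = cexp u (indicator A)"
  define b where "b = cexp v (indicator B)"
  define f :: "'a \<Rightarrow> real" where "f = indicator (A \<inter> B)"
  define g where "g = (\<lambda>\<omega>. a \<omega> * b \<omega>)"
  have a: "integrable M a" "a \<in> borel_measurable (fld u)" "a \<in> borel_measurable M"
    "AE \<omega> in M. \<bar>a \<omega>\<bar> \<le> 1"
    unfolding a_def using AM u by (auto intro: cexp_integrable cexp_measurable_M cexp_indicator_abs_le_1)
  have b: "integrable M b" "b \<in> borel_measurable (fld v)" "b \<in> borel_measurable M"
    "AE \<omega> in M. \<bar>b \<omega>\<bar> \<le> 1"
    unfolding b_def using BM v by (auto intro: cexp_integrable cexp_measurable_M cexp_indicator_abs_le_1)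
  have f: "integrable M f" "f \<in> borel_measurable M" "AE \<omega> in M. \<bar>f \<omega>\<bar> \<le> 1"
    unfolding f_def using AM BM by (auto simp: indicator_le_1)
  have g_int: "integrable M g" unfolding g_def by (rule integrable_bounded_mult[OF a(1) b(3,4)])
  have g_bd: "AE \<omega> in M. \<bar>g \<omega>\<bar> \<le> 1"
    using a(4) b(4) unfolding g_def
    by eventually_elim (simp add: abs_mult mult_le_one)
  have g_meas: "g \<in> borel_measurable (fld w)"
    unfolding g_def
    by (intro borel_measurable_times measurable_fld_mono[OF uw u(1) w a(2)]
        measurable_fld_mono[OF vw v(1) w b(2)])
  note g = g_int borel_measurable_integrable[OF g_int] g_bd
  have rect: "(\<integral>\<omega>. indicator C \<omega> * f \<omega> \<partial>M) = (\<integral>\<omega>. indicator C \<omega> * g \<omega> \<partial>M)"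
    if rectC: "C \<in> rectangles u v" for C
  proof -
    obtain A' B' where C: "C = A' \<inter> B'" "A' \<in> u" "B' \<in> v"
      using rectC by (auto simp: rectangles_def)
    have A': "A' \<in> sets M" "A' \<in> y" and B': "B' \<in> sets M" "B' \<in> z"
      using C u v sigma_field_events[OF u(1)] sigma_field_events[OF v(1)] by auto
    have part: "(\<integral>\<omega>. indicator D' \<omega> * cexp x (indicator D) \<omega> \<partial>M) = prob (D' \<inter> D)"
      if "x \<in> sigma_fields M" "D' \<in> x" "D \<in> sets M" for x D D'
    proof -
      have D': "D' \<in> sets M" by (rule sigma_field_events[OF that(1,2)])
      have eq: "(\<lambda>\<omega>. indicator D' \<omega> * indicator D \<omega>) = (indicator (D' \<inter> D) :: 'a \<Rightarrow> real)"
        by (simp add: fun_eq_iff indicator_inter_arith)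
      have "(\<integral>\<omega>. indicator D' \<omega> * cexp x (indicator D) \<omega> \<partial>M) = (\<integral>\<omega>. indicator D' \<omega> * indicator D \<omega> \<partial>M)"
        by (rule integral_mult_cexp[OF that(1)])
          (use that D' indicator_measurable_fld_iff[OF that(1) sets.sets_into_space[OF D']]
            in \<open>auto simp: eq\<close>)
      also have "\<dots> = prob (D' \<inter> D)" using that D' by (simp add: eq)
      finally show ?thesis .
    qed
    have "(\<lambda>\<omega>. indicator C \<omega> * f \<omega>) = indicator ((A' \<inter> A) \<inter> (B' \<inter> B))"
      by (auto simp: C f_def fun_eq_iff split: split_indicator)
    then have "(\<integral>\<omega>. indicator C \<omega> * f \<omega> \<partial>M) = prob ((A' \<inter> A) \<inter> (B' \<inter> B))"
      using A' B' AM BM by simp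
    also have "\<dots> = prob (A' \<inter> A) * prob (B' \<inter> B)"
      by (rule indep_set_fldD[OF ind sigma_field_Int[OF y A'(2) A] sigma_field_Int[OF z B'(2) B]])
    also have "\<dots> = (\<integral>\<omega>. indicator A' \<omega> * a \<omega> \<partial>M) * (\<integral>\<omega>. indicator B' \<omega> * b \<omega> \<partial>M)"
      unfolding a_def b_def using part[OF u(1) C(2) AM] part[OF v(1) C(3) BM] by simp
    also have "\<dots> = (\<integral>\<omega>. (indicator A' \<omega> * a \<omega>) * (indicator B' \<omega> * b \<omega>) \<partial>M)"
    proof (rule integral_mult_indep[OF y z ind, symmetric])
      have "(indicator A' :: 'a \<Rightarrow> real) \<in> borel_measurable (fld y)"
        using indicator_measurable_fld_iff[OF y sets.sets_into_space[OF A'(1)]] A' by simp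
      then show "(\<lambda>\<omega>. indicator A' \<omega> * a \<omega>) \<in> borel_measurable (fld y)"
        by (intro borel_measurable_times measurable_fld_mono[OF u(2) u(1) y a(2)])
      have "(indicator B' :: 'a \<Rightarrow> real) \<in> borel_measurable (fld z)"
        using indicator_measurable_fld_iff[OF z sets.sets_into_space[OF B'(1)]] B' by simp
      then show "(\<lambda>\<omega>. indicator B' \<omega> * b \<omega>) \<in> borel_measurable (fld z)"
        by (intro borel_measurable_times measurable_fld_mono[OF v(2) v(1) z b(2)])
      show "integrable M (\<lambda>\<omega>. indicator A' \<omega> * a \<omega>)"
        by (rule integrable_bounded_mult[OF _ a(3,4)]) (use A' in simp)
      show "integrable M (\<lambda>\<omega>. indicator B' \<omega> * b \<omega>)"
        by (rule integrable_bounded_mult[OF _ b(3,4)]) (use B' in simp)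
    qed
    also have "(\<lambda>\<omega>. (indicator A' \<omega> * a \<omega>) * (indicator B' \<omega> * b \<omega>)) = (\<lambda>\<omega>. indicator C \<omega> * g \<omega>)"
      by (auto simp: C g_def fun_eq_iff split: split_indicator)
    finally show ?thesis .
  qed
  have all: "(\<integral>\<omega>. h \<omega> * f \<omega> \<partial>M) = (\<integral>\<omega>. h \<omega> * g \<omega> \<partial>M)"
    if "integrable M h" "h \<in> borel_measurable (fld w)" for h :: "'a \<Rightarrow> real"
  proof (rule l1_class_induct[OF rectangles_pi_system(1-3)[OF u(1) v(1)] that(1)])
    show "h \<in> borel_measurable (fld (rectangles u v))"
      using that(2) by (simp add: rectangles_pi_system(4)[OF u(1) v(1)] w_def)
    show "(\<integral>\<omega>. indicator C \<omega> * f \<omega> \<partial>M) = (\<integral>\<omega>. indicator C \<omega> * g \<omega> \<partial>M)"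
      if "C \<in> rectangles u v" for C by (rule rect[OF that])
  next
    fix h k :: "'a \<Rightarrow> real"
    assume hk: "integrable M h" "integrable M k"
      "(\<integral>\<omega>. h \<omega> * f \<omega> \<partial>M) = (\<integral>\<omega>. h \<omega> * g \<omega> \<partial>M)" "(\<integral>\<omega>. k \<omega> * f \<omega> \<partial>M) = (\<integral>\<omega>. k \<omega> * g \<omega> \<partial>M)"
    then show "(\<integral>\<omega>. (h \<omega> + k \<omega>) * f \<omega> \<partial>M) = (\<integral>\<omega>. (h \<omega> + k \<omega>) * g \<omega> \<partial>M)"
      using integrable_bounded_mult[OF hk(1) f(2,3)] integrable_bounded_mult[OF hk(2) f(2,3)]
        integrable_bounded_mult[OF hk(1) g(2,3)] integrable_bounded_mult[OF hk(2) g(2,3)]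
      by (simp add: distrib_right)
  next
    fix c and h :: "'a \<Rightarrow> real"
    assume "(\<integral>\<omega>. h \<omega> * f \<omega> \<partial>M) = (\<integral>\<omega>. h \<omega> * g \<omega> \<partial>M)"
    then show "(\<integral>\<omega>. (c * h \<omega>) * f \<omega> \<partial>M) = (\<integral>\<omega>. (c * h \<omega>) * g \<omega> \<partial>M)"
      by (simp add: mult.assoc)
  next
    fix h :: "'a \<Rightarrow> real" and s
    assume h: "integrable M h" and s: "\<And>n. integrable M (s n)"
      and eq: "\<And>n. (\<integral>\<omega>. s n \<omega> * f \<omega> \<partial>M) = (\<integral>\<omega>. s n \<omega> * g \<omega> \<partial>M)"
      and lim: "(\<lambda>n. l1 (s n) h) \<longlonglongrightarrow> 0"
    show "(\<integral>\<omega>. h \<omega> * f \<omega> \<partial>M) = (\<integral>\<omega>. h \<omega> * g \<omega> \<partial>M)"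
      using integral_bounded_mult_tendsto[OF s h f(2,3) lim]
        integral_bounded_mult_tendsto[OF s h g(2,3) lim]
      unfolding eq by (rule LIMSEQ_unique)
  qed
  have "AE \<omega> in M. cexp w f \<omega> = g \<omega>"
  proof (rule cexp_unique[OF w f(1) g_int g_meas])
    fix C assume C: "C \<in> w"
    have CM: "C \<in> sets M" by (rule sigma_field_events[OF w C])
    have "(\<integral>\<omega>. indicator C \<omega> * f \<omega> \<partial>M) = (\<integral>\<omega>. indicator C \<omega> * g \<omega> \<partial>M)"
      by (rule all)
        (use C CM indicator_measurable_fld_iff[OF w sets.sets_into_space[OF CM]] in auto)
    then show "(\<integral>\<omega>\<in>C. f \<omega> \<partial>M) = (\<integral>\<omega>\<in>C. g \<omega> \<partial>M)"
      by (simp add: set_lebesgue_integral_def)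
  qed
  then show ?thesis by (simp add: w_def f_def g_def a_def b_def)
qed

lemma cexp_join_indep_left:
  assumes y: "y \<in> sigma_fields M" and z: "z \<in> sigma_fields M" and ind: "indep_set y z"
    and u: "u \<in> sigma_fields M" "u \<subseteq> y" and v: "v \<in> sigma_fields M" "v \<subseteq> z"
    and A: "A \<in> y"
  shows "AE \<omega> in M. cexp (join_field M u v) (indicator A) \<omega> = cexp u (indicator A) \<omega>"
proof -
  have "A \<inter> space M = A" using sets.sets_into_space[OF sigma_field_events[OF y A]] by auto
  then have "AE \<omega> in M. cexp (join_field M u v) (indicator A) \<omega>
      = cexp u (indicator A) \<omega> * cexp v (indicator (space M)) \<omega>"
    using cexp_join_indep[OF y z ind u v A sigma_field_space[OF z]] by simp
  moreover have "AE \<omega> in M. \<omega> \<in> space M" by (rule AE_space)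
  moreover have "AE \<omega> in M. cexp v (indicator (space M)) \<omega> = indicator (space M) \<omega>"
    by (rule cexp_indicator_fixes[OF v(1) sigma_field_space[OF v(1)]])
  ultimately show ?thesis by eventually_elim simp
qed

text \<open>
  On events of \<open>y\<close>, conditioning on the join is the same as conditioning on \<open>u\<close>, so an event of \<open>y\<close>
  that lies in the join is fixed by conditioning on \<open>u\<close>.
\<close>
lemma modular_law:
  assumes y: "y \<in> sigma_fields M" and z: "z \<in> sigma_fields M" and ind: "indep_set y z"
    and u: "u \<in> sigma_fields M" "u \<subseteq> y" and v: "v \<in> sigma_fields M" "v \<subseteq> z"
  shows "join_field M u v \<inter> y = u"
proof
  show "u \<subseteq> join_field M u v \<inter> y" using join_upper1 u(2) by auto
  show "join_field M u v \<inter> y \<subseteq> u"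
  proof
    fix A assume A: "A \<in> join_field M u v \<inter> y"
    have AM: "A \<in> sets M" using sigma_field_events[OF y] A by auto
    have "AE \<omega> in M. cexp (join_field M u v) (indicator A) \<omega> = indicator A \<omega>"
      by (rule cexp_indicator_fixes[OF join_in_sigma_fields[OF u(1) v(1)]]) (use A in auto)
    moreover have "AE \<omega> in M. cexp (join_field M u v) (indicator A) \<omega> = cexp u (indicator A) \<omega>"
      by (rule cexp_join_indep_left[OF y z ind u v]) (use A in auto)
    ultimately have "AE \<omega> in M. cexp u (indicator A) \<omega> = indicator A \<omega>" by eventually_elim simp
    then have "(indicator A :: 'a \<Rightarrow> real) \<in> borel_measurable (fld u)"
      by (intro measurable_fldI_cexp[OF u(1)]) (use AM in auto)
    then show "A \<in> u"
      using indicator_measurable_fld_iff[OF u(1) sets.sets_into_space[OF AM]] by simp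
  qed
qed

text \<open>
  The form in which the monotone class principle serves to bound sigma-fields from above: it is
  enough to know the conditional expectations of \<open>A \<inter> B\<close>.
\<close>
lemma cexp_measurable_of_rectangles:
  assumes u: "u \<in> sigma_fields M" and v: "v \<in> sigma_fields M" and x: "x \<in> sigma_fields M"
    and w: "w \<in> sigma_fields M"
    and base: "\<And>A B. A \<in> u \<Longrightarrow> B \<in> v \<Longrightarrow> cexp x (indicator (A \<inter> B)) \<in> borel_measurable (fld w)"
    and f: "integrable M f" "f \<in> borel_measurable (fld (join_field M u v))"
  shows "cexp x f \<in> borel_measurable (fld w)"
proof (rule l1_class_induct[OF rectangles_pi_system(1-3)[OF u v] f(1),
    where P="\<lambda>f. cexp x f \<in> borel_measurable (fld w)"])
  show "f \<in> borel_measurable (fld (rectangles u v))"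
    using f(2) by (simp add: rectangles_pi_system(4)[OF u v])
  show "cexp x (indicator C) \<in> borel_measurable (fld w)" if "C \<in> rectangles u v" for C
    using that base by (auto simp: rectangles_def)
next
  fix f g :: "'a \<Rightarrow> real"
  assume fg: "integrable M f" "integrable M g"
    "cexp x f \<in> borel_measurable (fld w)" "cexp x g \<in> borel_measurable (fld w)"
  show "cexp x (\<lambda>\<omega>. f \<omega> + g \<omega>) \<in> borel_measurable (fld w)"
  proof (rule measurable_fld_AE[OF w _ cexp_measurable_M[OF x]])
    show "(\<lambda>\<omega>. cexp x f \<omega> + cexp x g \<omega>) \<in> borel_measurable (fld w)"
      using fg(3,4) by (rule borel_measurable_add)
    show "AE \<omega> in M. cexp x f \<omega> + cexp x g \<omega> = cexp x (\<lambda>\<omega>. f \<omega> + g \<omega>) \<omega>"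
      using cexp_add[OF x fg(1,2)] by eventually_elim simp
  qed
next
  fix c :: real and f :: "'a \<Rightarrow> real"
  assume f: "integrable M f" "cexp x f \<in> borel_measurable (fld w)"
  show "cexp x (\<lambda>\<omega>. c * f \<omega>) \<in> borel_measurable (fld w)"
  proof (rule measurable_fld_AE[OF w _ cexp_measurable_M[OF x]])
    show "(\<lambda>\<omega>. c * cexp x f \<omega>) \<in> borel_measurable (fld w)"
      by (rule borel_measurable_times[OF borel_measurable_const f(2)])
    show "AE \<omega> in M. c * cexp x f \<omega> = cexp x (\<lambda>\<omega>. c * f \<omega>) \<omega>"
      using cexp_cmult[OF x f(1), of c] by eventually_elim simp
  qed
next
  fix f :: "'a \<Rightarrow> real" and s
  assume f: "integrable M f" and s: "\<And>n. integrable M (s n)"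
    and m: "\<And>n. cexp x (s n) \<in> borel_measurable (fld w)" and lim: "(\<lambda>n. l1 (s n) f) \<longlonglongrightarrow> 0"
  show "cexp x f \<in> borel_measurable (fld w)"
  proof (rule measurable_fld_l1_closed[OF w cexp_integrable[OF x f] cexp_integrable[OF x s] m])
    show "(\<lambda>n. l1 (cexp x (s n)) (cexp x f)) \<longlonglongrightarrow> 0"
      by (rule tendsto_sandwich[OF _ _ tendsto_const lim])
        (simp_all add: cexp_l1_contraction[OF x s f])
  qed
qed

lemma subset_of_rectangles:
  assumes u: "u \<in> sigma_fields M" and v: "v \<in> sigma_fields M" and x: "x \<in> sigma_fields M"
    and w: "w \<in> sigma_fields M"
    and base: "\<And>A B. A \<in> u \<Longrightarrow> B \<in> v \<Longrightarrow> cexp x (indicator (A \<inter> B)) \<in> borel_measurable (fld w)"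
    and gen: "join_field M u v = sets M"
  shows "x \<subseteq> w"
proof
  fix A assume A: "A \<in> x"
  have AM: "A \<in> sets M" by (rule sigma_field_events[OF x A])
  have "cexp x (indicator A) \<in> borel_measurable (fld w)"
    using AM by (intro cexp_measurable_of_rectangles[OF u v x w base])
      (auto simp: gen measurable_fld_sets)
  then have "(indicator A :: 'a \<Rightarrow> real) \<in> borel_measurable (fld w)"
    by (rule measurable_fld_AE[OF w _ _ cexp_indicator_fixes[OF x A]]) (use AM in auto)
  then show "A \<in> w"
    using indicator_measurable_fld_iff[OF w sets.sets_into_space[OF AM]] by simp
qed

section \<open>Commuting conditional expectations\<close>
definition preserves :: "'a set set \<Rightarrow> 'a set set \<Rightarrow> bool" where
  "preserves x y \<longleftrightarrow> (\<forall>f. integrable M f \<longrightarrow> f \<in> borel_measurable (fld y) \<longrightarrow>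
    cexp x f \<in> borel_measurable (fld y))"

lemma preserves_cexp:
  assumes x: "x \<in> sigma_fields M" and y: "y \<in> sigma_fields M" and p: "preserves x y"
    and f: "integrable M f" "f \<in> borel_measurable (fld y)"
  shows "AE \<omega> in M. cexp x f \<omega> = cexp (x \<inter> y) f \<omega>"
proof -
  have xy: "x \<inter> y \<in> sigma_fields M" by (rule Int_sigma_fields[OF x y])
  have "cexp x f \<in> borel_measurable (fld y)" using p f unfolding preserves_def by blast
  then have "cexp x f \<in> borel_measurable (fld (x \<inter> y))"
    by (rule measurable_fld_Int[OF x y cexp_measurable])
  then have "AE \<omega> in M. cexp (x \<inter> y) (cexp x f) \<omega> = cexp x f \<omega>"
    by (rule cexp_fixes[OF xy cexp_integrable[OF x f(1)]])
  moreover have "AE \<omega> in M. cexp (x \<inter> y) (cexp x f) \<omega> = cexp (x \<inter> y) f \<omega>"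
    by (rule cexp_tower[OF xy x _ f(1)]) simp
  ultimately show ?thesis by eventually_elim simp
qed

lemma preserves_cexp_cexp:
  assumes x: "x \<in> sigma_fields M" and y: "y \<in> sigma_fields M" and p: "preserves x y"
    and f: "integrable M f"
  shows "AE \<omega> in M. cexp x (cexp y f) \<omega> = cexp (x \<inter> y) f \<omega>"
proof -
  have "AE \<omega> in M. cexp x (cexp y f) \<omega> = cexp (x \<inter> y) (cexp y f) \<omega>"
    by (rule preserves_cexp[OF x y p cexp_integrable[OF y f] cexp_measurable])
  moreover have "AE \<omega> in M. cexp (x \<inter> y) (cexp y f) \<omega> = cexp (x \<inter> y) f \<omega>"
    by (rule cexp_tower[OF Int_sigma_fields[OF x y] y _ f]) simp
  ultimately show ?thesis by eventually_elim simp
qed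

text \<open>
  In the language of Hilbert spaces, a product of two orthogonal projections that is itself an
  orthogonal projection is the product in the other order as well. The computation moves conditional
  expectations from one factor of an integral to the other.
\<close>
lemma preserves_sym:
  assumes x: "x \<in> sigma_fields M" and y: "y \<in> sigma_fields M" and p: "preserves x y"
  shows "preserves y x"
  unfolding preserves_def
proof (intro allI impI)
  fix f :: "'a \<Rightarrow> real" assume f: "integrable M f" "f \<in> borel_measurable (fld x)"
  define w where "w = x \<inter> y"
  have w: "w \<in> sigma_fields M" unfolding w_def by (rule Int_sigma_fields[OF x y])
  have wx: "w \<subseteq> x" and wy: "w \<subseteq> y" by (auto simp: w_def)
  define g where "g = cexp w f"
  have g: "integrable M g" "g \<in> borel_measurable (fld w)"
    unfolding g_def by (rule cexp_integrable[OF w f(1)] cexp_measurable)+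
  have gx: "g \<in> borel_measurable (fld x)" by (rule measurable_fld_mono[OF wx w x g(2)])
  have "AE \<omega> in M. cexp y f \<omega> = g \<omega>"
  proof (rule cexp_unique[OF y f(1) g(1) measurable_fld_mono[OF wy w y g(2)]])
    fix A assume A: "A \<in> y"
    have AM: "A \<in> sets M" by (rule sigma_field_events[OF y A])
    have Ay: "(indicator A :: 'a \<Rightarrow> real) \<in> borel_measurable (fld y)"
      using A indicator_measurable_fld_iff[OF y sets.sets_into_space[OF AM]] by simp
    have Ai: "integrable M (indicator A :: 'a \<Rightarrow> real)" using AM by simp
    have bd1: "AE \<omega> in M. \<bar>indicator A \<omega> :: real\<bar> \<le> 1" by (simp add: indicator_le_1)
    define k where "k = cexp w (indicator A)"
    have k: "k \<in> borel_measurable (fld w)" "k \<in> borel_measurable M" "AE \<omega> in M. \<bar>k \<omega>\<bar> \<le> 1"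
      unfolding k_def by (rule cexp_measurable cexp_measurable_M[OF w] cexp_indicator_abs_le_1[OF w AM])+
    have eq: "AE \<omega> in M. cexp x (indicator A) \<omega> = k \<omega>"
      unfolding k_def w_def by (rule preserves_cexp[OF x y p Ai Ay])
    have h: "(\<integral>\<omega>. h \<omega> * indicator A \<omega> \<partial>M) = (\<integral>\<omega>. h \<omega> * k \<omega> \<partial>M)"
      if "integrable M h" "h \<in> borel_measurable (fld x)" for h :: "'a \<Rightarrow> real"
    proof -
      have hM: "h \<in> borel_measurable M" using that(1) by (rule borel_measurable_integrable)
      have "(\<integral>\<omega>. h \<omega> * indicator A \<omega> \<partial>M) = (\<integral>\<omega>. h \<omega> * cexp x (indicator A) \<omega> \<partial>M)"
        by (rule integral_mult_cexp[OF x that(2) _ integrable_bounded_mult[OF that(1) _ bd1], symmetric])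
          (use AM in auto)
      also have "\<dots> = (\<integral>\<omega>. h \<omega> * k \<omega> \<partial>M)"
      proof (rule integral_cong_AE)
        show "AE \<omega> in M. h \<omega> * cexp x (indicator A) \<omega> = h \<omega> * k \<omega>"
          using eq by eventually_elim simp
      qed (intro borel_measurable_times hM k(2) cexp_measurable_M[OF x])+
      finally show ?thesis .
    qed
    have "(\<integral>\<omega>. f \<omega> * indicator A \<omega> \<partial>M) = (\<integral>\<omega>. k \<omega> * f \<omega> \<partial>M)"
      using h[OF f] by (simp add: mult.commute)
    also have "\<dots> = (\<integral>\<omega>. k \<omega> * g \<omega> \<partial>M)"
      unfolding g_def
      by (rule integral_mult_cexp[OF w k(1), symmetric])
        (use f(1) integrable_bounded_mult[OF f(1) k(2,3)] in \<open>auto simp: mult.commute\<close>)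
    also have "\<dots> = (\<integral>\<omega>. g \<omega> * indicator A \<omega> \<partial>M)"
      using h[OF g(1) gx] by (simp add: mult.commute)
    finally show "(\<integral>\<omega>\<in>A. f \<omega> \<partial>M) = (\<integral>\<omega>\<in>A. g \<omega> \<partial>M)"
      by (simp add: set_lebesgue_integral_def mult.commute)
  qed
  then have "AE \<omega> in M. g \<omega> = cexp y f \<omega>" by eventually_elim simp
  then show "cexp y f \<in> borel_measurable (fld x)"
    by (rule measurable_fld_AE[OF x gx cexp_measurable_M[OF y]])
qed

lemma preserves_limit:
  assumes X: "\<And>n. X n \<in> sigma_fields M" and x: "x \<in> sigma_fields M" and y: "y \<in> sigma_fields M"
    and p: "\<And>n. preserves (X n) y" and lim: "sf_tendsto X x"
  shows "preserves x y"
  unfolding preserves_def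
proof (intro allI impI)
  fix f :: "'a \<Rightarrow> real" assume f: "integrable M f" "f \<in> borel_measurable (fld y)"
  show "cexp x f \<in> borel_measurable (fld y)"
  proof (rule measurable_fld_l1_closed[OF y cexp_integrable[OF x f(1)] cexp_integrable[OF X f(1)]])
    show "cexp (X n) f \<in> borel_measurable (fld y)" for n
      using p f unfolding preserves_def by blast
    show "(\<lambda>n. l1 (cexp (X n) f) (cexp x f)) \<longlonglongrightarrow> 0"
      using lim f(1) unfolding sf_tendsto_def by blast
  qed
qed

lemma cexp_trivial:
  assumes f: "integrable M f"
  shows "AE \<omega> in M. cexp (trivial_field M) f \<omega> = (\<integral>\<omega>. f \<omega> \<partial>M)"
proof (rule cexp_unique[OF trivial_field_in_sigma_fields f])
  fix A assume A: "A \<in> trivial_field M"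
  have AM: "A \<in> sets M" by (rule sigma_field_events[OF trivial_field_in_sigma_fields A])
  have case_null: "(\<integral>\<omega>. indicator N \<omega> * h \<omega> \<partial>M) = 0"
    if "N \<in> null_sets M" for N and h :: "'a \<Rightarrow> real"
  proof -
    have "AE \<omega> in M. indicator N \<omega> * h \<omega> = 0"
      using AE_not_in[OF that] by eventually_elim simp
    then show ?thesis by (rule integral_eq_zero_AE)
  qed
  have case_co: "(\<integral>\<omega>. indicator A \<omega> * h \<omega> \<partial>M) = (\<integral>\<omega>. h \<omega> \<partial>M)"
    if "N \<in> null_sets M" "A = space M - N" "integrable M h" for N and h :: "'a \<Rightarrow> real"
  proof (rule integral_cong_AE)
    show "AE \<omega> in M. indicator A \<omega> * h \<omega> = h \<omega>"
      using AE_not_in[OF that(1)] AE_space by eventually_elim (simp add: that(2))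
    show "h \<in> borel_measurable M" using that(3) by (rule borel_measurable_integrable)
    then show "(\<lambda>\<omega>. indicator A \<omega> * h \<omega>) \<in> borel_measurable M"
      by (rule borel_measurable_times[OF borel_measurable_indicator[OF AM]])
  qed
  have "(\<integral>\<omega>. indicator A \<omega> * f \<omega> \<partial>M) = (\<integral>\<omega>. indicator A \<omega> * (\<integral>\<omega>. f \<omega> \<partial>M) \<partial>M)"
    using A unfolding trivial_field_def
  proof (elim UnE CollectE exE conjE)
    assume "A \<in> null_sets M"
    then show ?thesis by (simp only: case_null)
  next
    fix N assume N: "A = space M - N" "N \<in> null_sets M"
    show ?thesis
      by (simp only: case_co[OF N(2,1) f] case_co[OF N(2,1) integrable_const]) (simp add: prob_space)
  qed
  then show "(\<integral>\<omega>\<in>A. f \<omega> \<partial>M) = (\<integral>\<omega>\<in>A. (\<integral>\<omega>. f \<omega> \<partial>M) \<partial>M)"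
    by (simp add: set_lebesgue_integral_def)
qed auto

text \<open>
  For \<open>B\<close> in \<open>y\<close>, the conditional probability of \<open>B\<close> given \<open>x\<close> equals the one given \<open>x \<inter> y\<close>,
  which is the constant \<open>prob B\<close>.
\<close>
lemma indep_set_of_preserves:
  assumes x: "x \<in> sigma_fields M" and y: "y \<in> sigma_fields M" and p: "preserves x y"
    and triv: "x \<inter> y = trivial_field M"
  shows "indep_set x y"
  unfolding indep_sets2_eq
proof (intro conjI ballI)
  show "x \<subseteq> sets M" "y \<subseteq> sets M" using x y by (auto simp: sigma_fields_def)
  fix A B assume A: "A \<in> x" and B: "B \<in> y"
  have AM: "A \<in> sets M" and BM: "B \<in> sets M"
    using sigma_field_events[OF x A] sigma_field_events[OF y B] by auto
  have Ax: "(indicator A :: 'a \<Rightarrow> real) \<in> borel_measurable (fld x)"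
    using A indicator_measurable_fld_iff[OF x sets.sets_into_space[OF AM]] by simp
  have By: "(indicator B :: 'a \<Rightarrow> real) \<in> borel_measurable (fld y)"
    using B indicator_measurable_fld_iff[OF y sets.sets_into_space[OF BM]] by simp
  have Bi: "integrable M (indicator B :: 'a \<Rightarrow> real)" using BM by simp
  have eq: "(\<lambda>\<omega>. indicator A \<omega> * indicator B \<omega>) = (indicator (A \<inter> B) :: 'a \<Rightarrow> real)"
    by (simp add: fun_eq_iff indicator_inter_arith)
  have "AE \<omega> in M. cexp (trivial_field M) (indicator B) \<omega> = prob B"
    using cexp_trivial[OF Bi] BM by simp
  with preserves_cexp[OF x y p Bi By]
  have ae: "AE \<omega> in M. cexp x (indicator B) \<omega> = prob B"
    unfolding triv by eventually_elim simp
  have "prob (A \<inter> B) = (\<integral>\<omega>. indicator A \<omega> * indicator B \<omega> \<partial>M)"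
    using AM BM by (simp add: eq)
  also have "\<dots> = (\<integral>\<omega>. indicator A \<omega> * cexp x (indicator B) \<omega> \<partial>M)"
    by (rule integral_mult_cexp[OF x Ax, symmetric]) (use AM BM in \<open>auto simp: eq\<close>)
  also have "\<dots> = (\<integral>\<omega>. indicator A \<omega> * prob B \<partial>M)"
  proof (rule integral_cong_AE)
    show "AE \<omega> in M. indicator A \<omega> * cexp x (indicator B) \<omega> = indicator A \<omega> * prob B"
      using ae by eventually_elim simp
  qed (intro borel_measurable_times borel_measurable_indicator AM cexp_measurable_M[OF x]
      borel_measurable_const)+
  also have "\<dots> = prob A * prob B" using AM by simp
  finally show "prob (A \<inter> B) = prob A * prob B" .
qed

section \<open>Meets, joins and splittings in the limit\<close>
lemma l1_tendsto_mult:
  assumes f: "\<And>n. integrable M (f n)" "integrable M f'" and g: "\<And>n. integrable M (g n)" "integrable M g'"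
    and bd: "AE \<omega> in M. \<bar>f' \<omega>\<bar> \<le> 1" "\<And>n. AE \<omega> in M. \<bar>g n \<omega>\<bar> \<le> 1" "AE \<omega> in M. \<bar>g' \<omega>\<bar> \<le> 1"
    and lim: "(\<lambda>n. l1 (f n) f') \<longlonglongrightarrow> 0" "(\<lambda>n. l1 (g n) g') \<longlonglongrightarrow> 0"
  shows "(\<lambda>n. l1 (\<lambda>\<omega>. f n \<omega> * g n \<omega>) (\<lambda>\<omega>. f' \<omega> * g' \<omega>)) \<longlonglongrightarrow> 0"
proof (rule tendsto_sandwich[OF _ _ tendsto_const])
  show "(\<lambda>n. l1 (f n) f' + l1 (g n) g') \<longlonglongrightarrow> 0" using tendsto_add[OF lim] by simp
  show "\<forall>\<^sub>F n in sequentially. l1 (\<lambda>\<omega>. f n \<omega> * g n \<omega>) (\<lambda>\<omega>. f' \<omega> * g' \<omega>) \<le> l1 (f n) f' + l1 (g n) g'"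
  proof (rule always_eventually, rule allI)
    fix n
    note prod = integrable_bounded_mult[OF f(1) borel_measurable_integrable[OF g(1)] bd(2), of n n]
      integrable_bounded_mult[OF f(2) borel_measurable_integrable[OF g(2)] bd(3)]
    have "l1 (\<lambda>\<omega>. f n \<omega> * g n \<omega>) (\<lambda>\<omega>. f' \<omega> * g' \<omega>) \<le> (\<integral>\<omega>. \<bar>f n \<omega> - f' \<omega>\<bar> + \<bar>g n \<omega> - g' \<omega>\<bar> \<partial>M)"
      unfolding l1_def
    proof (rule integral_mono_AE)
      show "AE \<omega> in M. \<bar>f n \<omega> * g n \<omega> - f' \<omega> * g' \<omega>\<bar> \<le> \<bar>f n \<omega> - f' \<omega>\<bar> + \<bar>g n \<omega> - g' \<omega>\<bar>"
        using bd(1) bd(2)[of n]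
      proof eventually_elim
        case (elim \<omega>)
        have "f n \<omega> * g n \<omega> - f' \<omega> * g' \<omega> = (f n \<omega> - f' \<omega>) * g n \<omega> + f' \<omega> * (g n \<omega> - g' \<omega>)"
          by (simp add: algebra_simps)
        then have "\<bar>f n \<omega> * g n \<omega> - f' \<omega> * g' \<omega>\<bar>
            \<le> \<bar>f n \<omega> - f' \<omega>\<bar> * \<bar>g n \<omega>\<bar> + \<bar>f' \<omega>\<bar> * \<bar>g n \<omega> - g' \<omega>\<bar>"
          by (metis abs_mult abs_triangle_ineq)
        also have "\<dots> \<le> \<bar>f n \<omega> - f' \<omega>\<bar> * 1 + 1 * \<bar>g n \<omega> - g' \<omega>\<bar>"
          by (intro add_mono mult_left_mono mult_right_mono elim) auto
        finally show ?case by simp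
      qed
    qed (use prod f g in auto)
    also have "\<dots> = l1 (f n) f' + l1 (g n) g'"
      unfolding l1_def by (rule Bochner_Integration.integral_add) (use f g in auto)
    finally show "l1 (\<lambda>\<omega>. f n \<omega> * g n \<omega>) (\<lambda>\<omega>. f' \<omega> * g' \<omega>) \<le> l1 (f n) f' + l1 (g n) g'" .
  qed
qed simp

lemma sf_tendstoD:
  "sf_tendsto X x \<Longrightarrow> integrable M f \<Longrightarrow> (\<lambda>n. l1 (cexp (X n) f) (cexp x f)) \<longlonglongrightarrow> 0"
  unfolding sf_tendsto_def by blast

text \<open>
  The meet of commuting sigma-fields corresponds to the product of two operators, and strong
  convergence is compatible with products of contractions.
\<close>
lemma sf_tendsto_meet:
  assumes X: "\<And>n. X n \<in> sigma_fields M" and x: "x \<in> sigma_fields M"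
    and Y: "\<And>n. Y n \<in> sigma_fields M" and y: "y \<in> sigma_fields M"
    and pn: "\<And>n. preserves (X n) (Y n)" and p: "preserves x y"
    and lim: "sf_tendsto X x" "sf_tendsto Y y"
  shows "sf_tendsto (\<lambda>n. X n \<inter> Y n) (x \<inter> y)"
  unfolding sf_tendsto_def
proof (intro allI impI, rule tendsto_sandwich[OF _ _ tendsto_const])
  fix f :: "'a \<Rightarrow> real" assume f: "integrable M f"
  let ?g = "cexp y f"
  have g: "integrable M ?g" by (rule cexp_integrable[OF y f])
  show "(\<lambda>n. l1 (cexp (Y n) f) ?g + l1 (cexp (X n) ?g) (cexp x ?g)) \<longlonglongrightarrow> 0"
    using tendsto_add[OF sf_tendstoD[OF lim(2) f] sf_tendstoD[OF lim(1) g]] by simp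
  show "\<forall>\<^sub>F n in sequentially. l1 (cexp (X n \<inter> Y n) f) (cexp (x \<inter> y) f)
      \<le> l1 (cexp (Y n) f) ?g + l1 (cexp (X n) ?g) (cexp x ?g)"
  proof (rule always_eventually, rule allI)
    fix n
    note gn = cexp_integrable[OF Y[of n] f]
    note int = cexp_integrable[OF X[of n] gn] cexp_integrable[OF X[of n] g] cexp_integrable[OF x g]
      cexp_integrable[OF Int_sigma_fields[OF X[of n] Y[of n]] f]
      cexp_integrable[OF Int_sigma_fields[OF x y] f]
    have "l1 (cexp (X n \<inter> Y n) f) (cexp (x \<inter> y) f) = l1 (cexp (X n) (cexp (Y n) f)) (cexp x ?g)"
      by (rule l1_cong_AE[symmetric, OF preserves_cexp_cexp[OF X Y pn f] preserves_cexp_cexp[OF x y p f]])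
        (rule int)+
    also have "\<dots> \<le> l1 (cexp (X n) (cexp (Y n) f)) (cexp (X n) ?g) + l1 (cexp (X n) ?g) (cexp x ?g)"
      by (rule l1_triangle) (rule int)+
    also have "l1 (cexp (X n) (cexp (Y n) f)) (cexp (X n) ?g) \<le> l1 (cexp (Y n) f) ?g"
      by (rule cexp_l1_contraction[OF X gn g])
    finally show "l1 (cexp (X n \<inter> Y n) f) (cexp (x \<inter> y) f)
      \<le> l1 (cexp (Y n) f) ?g + l1 (cexp (X n) ?g) (cexp x ?g)" by simp
  qed
qed simp

lemma sf_tendsto_const: "sf_tendsto (\<lambda>n. x) x"
  by (simp add: sf_tendsto_def l1_def)

text \<open>
  Confining the \<open>W n\<close> to \<open>z\<close> is essential: by the tensor product formula, only the factor belonging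
  to \<open>z\<close> depends on \<open>n\<close>.
\<close>
lemma sf_tendsto_join:
  assumes y: "y \<in> sigma_fields M" and z: "z \<in> sigma_fields M" and ind: "indep_set y z"
    and gen: "join_field M y z = sets M"
    and W: "\<And>n. W n \<in> sigma_fields M" "\<And>n. W n \<subseteq> z" and w: "w \<in> sigma_fields M" "w \<subseteq> z"
    and lim: "sf_tendsto W w"
  shows "sf_tendsto (\<lambda>n. join_field M y (W n)) (join_field M y w)"
  unfolding sf_tendsto_def
proof (intro allI impI)
  fix f :: "'a \<Rightarrow> real" assume f: "integrable M f"
  have J: "join_field M y (W n) \<in> sigma_fields M" for n by (rule join_in_sigma_fields[OF y W(1)])
  have j: "join_field M y w \<in> sigma_fields M" by (rule join_in_sigma_fields[OF y w(1)])
  show "(\<lambda>n. l1 (cexp (join_field M y (W n)) f) (cexp (join_field M y w) f)) \<longlonglongrightarrow> 0"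
  proof (rule cexp_tendsto_generator[OF J j rectangles_pi_system(1-3)[OF y z] f])
    show "f \<in> borel_measurable (fld (rectangles y z))"
      using f by (simp add: rectangles_pi_system(4)[OF y z] gen measurable_fld_sets)
    fix C assume "C \<in> rectangles y z"
    then obtain A B where C: "C = A \<inter> B" and A: "A \<in> y" and B: "B \<in> z"
      by (auto simp: rectangles_def)
    have AM: "A \<in> sets M" and BM: "B \<in> sets M"
      using sigma_field_events[OF y A] sigma_field_events[OF z B] by auto
    have Ci: "integrable M (indicator C :: 'a \<Rightarrow> real)" using AM BM by (simp add: C)
    have Ai: "integrable M (indicator A :: 'a \<Rightarrow> real)" using AM by simp
    have Bi: "integrable M (indicator B :: 'a \<Rightarrow> real)" using BM by simp
    let ?a = "cexp y (indicator A)"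
    let ?b = "\<lambda>n. cexp (W n) (indicator B)"
    let ?c = "cexp w (indicator B)"
    note int = cexp_integrable[OF y Ai] cexp_integrable[OF W(1) Bi] cexp_integrable[OF w(1) Bi]
    note bd = cexp_indicator_abs_le_1[OF y AM] cexp_indicator_abs_le_1[OF W(1) BM]
      cexp_indicator_abs_le_1[OF w(1) BM]
    have "(\<lambda>n. l1 (\<lambda>\<omega>. ?a \<omega> * ?b n \<omega>) (\<lambda>\<omega>. ?a \<omega> * ?c \<omega>)) \<longlonglongrightarrow> 0"
    proof (rule l1_tendsto_mult[OF int(1,1,2,3) bd])
      show "(\<lambda>n. l1 ?a ?a) \<longlonglongrightarrow> 0" by (simp add: l1_def)
      show "(\<lambda>n. l1 (?b n) ?c) \<longlonglongrightarrow> 0" by (rule sf_tendstoD[OF lim Bi])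
    qed
    moreover have "l1 (\<lambda>\<omega>. ?a \<omega> * ?b n \<omega>) (\<lambda>\<omega>. ?a \<omega> * ?c \<omega>)
        = l1 (cexp (join_field M y (W n)) (indicator C)) (cexp (join_field M y w) (indicator C))" for n
      unfolding C
      by (rule l1_cong_AE[symmetric, OF cexp_join_indep[OF y z ind y order_refl W A B]
            cexp_join_indep[OF y z ind y order_refl w A B]])
        (use Ci int bd borel_measurable_integrable[OF int(2)] borel_measurable_integrable[OF int(3)]
          in \<open>auto simp: C intro: cexp_integrable[OF J] cexp_integrable[OF j] integrable_bounded_mult\<close>)
    ultimately show "(\<lambda>n. l1 (cexp (join_field M y (W n)) (indicator C))
        (cexp (join_field M y w) (indicator C))) \<longlonglongrightarrow> 0" by simp
  qed
qed

text \<open>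
  For \<open>A\<close> in \<open>y\<close> and \<open>B\<close> in \<open>z\<close>, the splitting of \<open>X n\<close> says that its conditional expectations are
  multiplicative on \<open>A \<inter> B\<close>. This passes to the limit and shows that conditioning on \<open>x\<close> sends
  these indicators, which generate everything, to functions measurable for the join of \<open>x \<inter> y\<close> and
  \<open>x \<inter> z\<close>.
\<close>
lemma splitting_limit:
  assumes y: "y \<in> sigma_fields M" and z: "z \<in> sigma_fields M" and ind: "indep_set y z"
    and gen: "join_field M y z = sets M"
    and X: "\<And>n. X n \<in> sigma_fields M" and x: "x \<in> sigma_fields M" and lim: "sf_tendsto X x"
    and py: "\<And>n. preserves (X n) y" and pz: "\<And>n. preserves (X n) z"
    and split: "\<And>n. X n = join_field M (X n \<inter> y) (X n \<inter> z)"
  shows "x = join_field M (x \<inter> y) (x \<inter> z)"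
proof
  define w where "w = join_field M (x \<inter> y) (x \<inter> z)"
  note xy = Int_sigma_fields[OF x y] and xz = Int_sigma_fields[OF x z]
  have w: "w \<in> sigma_fields M" unfolding w_def by (rule join_in_sigma_fields[OF xy xz])
  show "join_field M (x \<inter> y) (x \<inter> z) \<subseteq> x" by (rule join_least[OF x]) auto
  have "x \<subseteq> w"
  proof (rule subset_of_rectangles[OF y z x w _ gen])
    fix A B assume A: "A \<in> y" and B: "B \<in> z"
    have AM: "A \<in> sets M" and BM: "B \<in> sets M"
      using sigma_field_events[OF y A] sigma_field_events[OF z B] by auto
    have Ai: "integrable M (indicator A :: 'a \<Rightarrow> real)" and Bi: "integrable M (indicator B :: 'a \<Rightarrow> real)"
      and ABi: "integrable M (indicator (A \<inter> B) :: 'a \<Rightarrow> real)"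
      using AM BM by simp_all
    have Ay: "(indicator A :: 'a \<Rightarrow> real) \<in> borel_measurable (fld y)"
      using A indicator_measurable_fld_iff[OF y sets.sets_into_space[OF AM]] by simp
    have Bz: "(indicator B :: 'a \<Rightarrow> real) \<in> borel_measurable (fld z)"
      using B indicator_measurable_fld_iff[OF z sets.sets_into_space[OF BM]] by simp
    let ?a = "\<lambda>x. cexp x (indicator A)" and ?b = "\<lambda>x. cexp x (indicator B)"
      and ?c = "\<lambda>x. cexp x (indicator (A \<inter> B))"
    note int = cexp_integrable[OF X Ai] cexp_integrable[OF x Ai]
      cexp_integrable[OF X Bi] cexp_integrable[OF x Bi]
    note bd = cexp_indicator_abs_le_1[OF x AM] cexp_indicator_abs_le_1[OF X BM]
      cexp_indicator_abs_le_1[OF x BM]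
    have prodn: "AE \<omega> in M. ?a (X n) \<omega> * ?b (X n) \<omega> = ?c (X n) \<omega>" for n
    proof -
      have "AE \<omega> in M. ?c (join_field M (X n \<inter> y) (X n \<inter> z)) \<omega> = ?a (X n \<inter> y) \<omega> * ?b (X n \<inter> z) \<omega>"
        by (rule cexp_join_indep[OF y z ind Int_sigma_fields[OF X y] _ Int_sigma_fields[OF X z] _ A B]) auto
      with preserves_cexp[OF X y py Ai Ay, of n] preserves_cexp[OF X z pz Bi Bz, of n]
      show ?thesis unfolding split[symmetric] by eventually_elim simp
    qed
    have prod_int: "integrable M (\<lambda>\<omega>. ?a (X n) \<omega> * ?b (X n) \<omega>)" for n
      by (rule integrable_bounded_mult[OF int(1) borel_measurable_integrable[OF int(3)] bd(2)])
    have prod_int': "integrable M (\<lambda>\<omega>. ?a x \<omega> * ?b x \<omega>)"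
      by (rule integrable_bounded_mult[OF int(2) borel_measurable_integrable[OF int(4)] bd(3)])
    have "(\<lambda>n. l1 (\<lambda>\<omega>. ?a (X n) \<omega> * ?b (X n) \<omega>) (\<lambda>\<omega>. ?a x \<omega> * ?b x \<omega>)) \<longlonglongrightarrow> 0"
      by (rule l1_tendsto_mult[OF int bd sf_tendstoD[OF lim Ai] sf_tendstoD[OF lim Bi]])
    moreover have "l1 (\<lambda>\<omega>. ?a (X n) \<omega> * ?b (X n) \<omega>) (\<lambda>\<omega>. ?a x \<omega> * ?b x \<omega>)
        = l1 (?c (X n)) (\<lambda>\<omega>. ?a x \<omega> * ?b x \<omega>)" for n
      by (rule l1_cong_AE[OF prodn AE_I2[OF refl] prod_int cexp_integrable[OF X ABi] prod_int' prod_int'])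
    ultimately have "(\<lambda>n. l1 (?c (X n)) (\<lambda>\<omega>. ?a x \<omega> * ?b x \<omega>)) \<longlonglongrightarrow> 0" by simp
    from l1_limit_unique[OF prod_int' cexp_integrable[OF x ABi] cexp_integrable[OF X ABi]
        this sf_tendstoD[OF lim ABi]]
    have eq: "AE \<omega> in M. ?a x \<omega> * ?b x \<omega> = ?c x \<omega>" .
    have "preserves x y" by (rule preserves_limit[OF X x y py lim])
    then have "?a x \<in> borel_measurable (fld (x \<inter> y))"
      using Ai Ay unfolding preserves_def by (intro measurable_fld_Int[OF x y cexp_measurable]) blast
    then have aw: "?a x \<in> borel_measurable (fld w)"
      using measurable_fld_mono[OF _ xy w] join_upper1 unfolding w_def by blast
    have "preserves x z" by (rule preserves_limit[OF X x z pz lim])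
    then have "?b x \<in> borel_measurable (fld (x \<inter> z))"
      using Bi Bz unfolding preserves_def by (intro measurable_fld_Int[OF x z cexp_measurable]) blast
    then have bw: "?b x \<in> borel_measurable (fld w)"
      using measurable_fld_mono[OF _ xz w] join_upper2 unfolding w_def by blast
    show "?c x \<in> borel_measurable (fld w)"
      by (rule measurable_fld_AE[OF w borel_measurable_times[OF aw bw] cexp_measurable_M[OF x] eq])
  qed
  then show "x \<subseteq> join_field M (x \<inter> y) (x \<inter> z)" by (simp add: w_def)
qed

text \<open>
  The tensor product formula with the trivial sigma-field on the side of \<open>z\<close>.
\<close>
lemma cexp_rectangle_indep:
  assumes y: "y \<in> sigma_fields M" and z: "z \<in> sigma_fields M" and ind: "indep_set y z"
    and A: "A \<in> y" and B: "B \<in> z"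
  shows "AE \<omega> in M. cexp y (indicator (A \<inter> B)) \<omega> = indicator A \<omega> * prob B"
proof -
  have t: "trivial_field M \<in> sigma_fields M" by (rule trivial_field_in_sigma_fields)
  have BM: "B \<in> sets M" by (rule sigma_field_events[OF z B])
  have jy: "join_field M y (trivial_field M) = y"
    by (intro equalityI join_least[OF y] join_upper1 order_refl trivial_field_least[OF y])
  have "AE \<omega> in M. cexp (join_field M y (trivial_field M)) (indicator (A \<inter> B)) \<omega>
      = cexp y (indicator A) \<omega> * cexp (trivial_field M) (indicator B) \<omega>"
    by (rule cexp_join_indep[OF y z ind y order_refl t trivial_field_least[OF z] A B])
  moreover have "AE \<omega> in M. cexp (trivial_field M) (indicator B) \<omega> = prob B"
    using cexp_trivial[of "indicator B"] BM by simp
  ultimately show ?thesis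
    using cexp_indicator_fixes[OF y A] unfolding jy by eventually_elim simp
qed

text \<open>
  Conditioning \<open>A \<inter> B\<close> on \<open>y\<close>, for \<open>A\<close> in \<open>u\<close> and \<open>B\<close> in \<open>v\<close>, gives a multiple of the indicator of
  \<open>A\<close>; as these events generate everything, all of \<open>y\<close> is in \<open>u\<close>.
\<close>
lemma generating_part_is_all:
  assumes y: "y \<in> sigma_fields M" and z: "z \<in> sigma_fields M" and ind: "indep_set y z"
    and u: "u \<in> sigma_fields M" "u \<subseteq> y" and v: "v \<in> sigma_fields M" "v \<subseteq> z"
    and gen: "join_field M u v = sets M"
  shows "u = y"
proof (rule equalityI[OF u(2)], rule subset_of_rectangles[OF u(1) v(1) y u(1) _ gen])
  fix A B assume A: "A \<in> u" and B: "B \<in> v"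
  have AM: "A \<in> sets M" by (rule sigma_field_events[OF u(1) A])
  have "AE \<omega> in M. cexp y (indicator (A \<inter> B)) \<omega> = indicator A \<omega> * prob B"
    by (rule cexp_rectangle_indep[OF y z ind]) (use A B u(2) v(2) in auto)
  then have ae: "AE \<omega> in M. indicator A \<omega> * prob B = cexp y (indicator (A \<inter> B)) \<omega>"
    by eventually_elim simp
  have "(indicator A :: 'a \<Rightarrow> real) \<in> borel_measurable (fld u)"
    using A indicator_measurable_fld_iff[OF u(1) sets.sets_into_space[OF AM]] by simp
  then have "(\<lambda>\<omega>. indicator A \<omega> * prob B) \<in> borel_measurable (fld u)"
    by (rule borel_measurable_times[OF _ borel_measurable_const])
  then show "cexp y (indicator (A \<inter> B)) \<in> borel_measurable (fld u)"
    by (rule measurable_fld_AE[OF u(1) _ cexp_measurable_M[OF y] ae])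
qed

text \<open>
  On \<open>y\<close>, conditioning on \<open>x\<close> retains \<open>y \<inter> x\<close> and averages over \<open>y \<inter> x'\<close>; neither
  operation leaves \<open>y\<close>.
\<close>
lemma preserves_of_splitting:
  assumes x: "x \<in> sigma_fields M" and x': "x' \<in> sigma_fields M" and ind: "indep_set x x'"
    and y: "y \<in> sigma_fields M" and split: "y = join_field M (y \<inter> x) (y \<inter> x')"
  shows "preserves x y"
  unfolding preserves_def
proof (intro allI impI)
  fix f :: "'a \<Rightarrow> real" assume f: "integrable M f" "f \<in> borel_measurable (fld y)"
  show "cexp x f \<in> borel_measurable (fld y)"
  proof (rule cexp_measurable_of_rectangles[OF Int_sigma_fields[OF y x] Int_sigma_fields[OF y x'] x y _ f(1)])
    show "f \<in> borel_measurable (fld (join_field M (y \<inter> x) (y \<inter> x')))" using f(2) split by simp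
    fix A B assume A: "A \<in> y \<inter> x" and B: "B \<in> y \<inter> x'"
    have AM: "A \<in> sets M" using sigma_field_events[OF y] A by auto
    have "AE \<omega> in M. cexp x (indicator (A \<inter> B)) \<omega> = indicator A \<omega> * prob B"
      by (rule cexp_rectangle_indep[OF x x' ind]) (use A B in auto)
    then have ae: "AE \<omega> in M. indicator A \<omega> * prob B = cexp x (indicator (A \<inter> B)) \<omega>"
      by eventually_elim simp
    have "(indicator A :: 'a \<Rightarrow> real) \<in> borel_measurable (fld y)"
      using A indicator_measurable_fld_iff[OF y sets.sets_into_space[OF AM]] by simp
    then have "(\<lambda>\<omega>. indicator A \<omega> * prob B) \<in> borel_measurable (fld y)"
      by (rule borel_measurable_times[OF _ borel_measurable_const])
    then show "cexp x (indicator (A \<inter> B)) \<in> borel_measurable (fld y)"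
      by (rule measurable_fld_AE[OF y _ cexp_measurable_M[OF x] ae])
  qed
qed

text \<open>
  What \<open>v\<close> adds to \<open>b\<close> is only its part in \<open>c\<close>. This brings a join into the form that is
  continuous, with \<open>c\<close> complementary to \<open>b\<close>.
\<close>
lemma join_absorb:
  assumes b: "b \<in> sigma_fields M" and v: "v \<in> sigma_fields M" and c: "c \<in> sigma_fields M"
    and split: "v = join_field M (v \<inter> b) (v \<inter> c)"
  shows "join_field M b (v \<inter> c) = join_field M b v"
proof
  note bv = join_in_sigma_fields[OF b v] and bvc = join_in_sigma_fields[OF b Int_sigma_fields[OF v c]]
  show "join_field M b (v \<inter> c) \<subseteq> join_field M b v"
    by (rule join_least[OF bv join_upper1]) (use join_upper2[of v b] in auto)
  have "join_field M (v \<inter> b) (v \<inter> c) \<subseteq> join_field M b (v \<inter> c)"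
    by (rule join_least[OF bvc _ join_upper2]) (use join_upper1[of b "v \<inter> c"] in auto)
  then show "join_field M b v \<subseteq> join_field M b (v \<inter> c)"
    using split by (intro join_least[OF bvc join_upper1]) simp
qed

section \<open>Lower limits as limits\<close>
text \<open>
  The quadratic mean dominates the mean, so a dense sequence of square-integrable functions
  approximates indicators in mean.
\<close>
lemma separable_L2_dense_sequence:
  assumes "separable_L2 M"
  shows "\<exists>d :: nat \<Rightarrow> 'a \<Rightarrow> real. (\<forall>i. integrable M (d i)) \<and>
    (\<forall>A e. A \<in> sets M \<longrightarrow> e > 0 \<longrightarrow> (\<exists>i. l1 (d i) (indicator A) < e))"
proof -
  obtain D where D: "countable D" "D \<subseteq> L2_functions M"
    "\<And>f e. f \<in> L2_functions M \<Longrightarrow> e > 0 \<Longrightarrow> \<exists>g\<in>D. sqrt (\<integral>\<omega>. (f \<omega> - g \<omega>)\<^sup>2 \<partial>M) < e"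
    using assms unfolding separable_L2_def by blast
  have ind: "(indicator A :: 'a \<Rightarrow> real) \<in> L2_functions M" if "A \<in> sets M" for A
  proof -
    have "(\<lambda>\<omega>. (indicator A \<omega> :: real)\<^sup>2) = indicator A" by (auto split: split_indicator)
    then show ?thesis using that by (simp add: L2_functions_def)
  qed
  have "D \<noteq> {}" using D(3)[OF ind[OF sets.top], of 1] by auto
  define d where "d = from_nat_into D"
  have rng: "range d = D" unfolding d_def by (rule range_from_nat_into[OF \<open>D \<noteq> {}\<close> D(1)])
  have dL: "d i \<in> L2_functions M" for i using rng D(2) by auto
  have int: "integrable M f" if "f \<in> L2_functions M" for f
    by (rule square_integrable_imp_integrable) (use that in \<open>simp_all add: L2_functions_def\<close>)
  show ?thesis
  proof (intro exI[of _ d] conjI allI impI)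
    show "integrable M (d i)" for i by (rule int[OF dL])
    fix A and e :: real assume A: "A \<in> sets M" and e: "e > 0"
    obtain g where g: "g \<in> D" "sqrt (\<integral>\<omega>. (indicator A \<omega> - g \<omega>)\<^sup>2 \<partial>M) < e"
      using D(3)[OF ind[OF A] e] by blast
    obtain i where i: "d i = g" using g(1) rng by auto
    have gi: "integrable M g" "integrable M (\<lambda>\<omega>. (g \<omega>)\<^sup>2)"
      using dL[of i] int[OF dL[of i]] by (auto simp: i L2_functions_def)
    have "integrable M (\<lambda>\<omega>. g \<omega> * indicator A \<omega>)"
      by (rule integrable_bounded_mult[OF gi(1)]) (use A in \<open>auto simp: indicator_le_1\<close>)
    moreover have "(\<lambda>\<omega>. (indicator A \<omega> - g \<omega>)\<^sup>2)
        = (\<lambda>\<omega>. indicator A \<omega> - 2 * (g \<omega> * indicator A \<omega>) + (g \<omega>)\<^sup>2)"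
      by (auto simp: fun_eq_iff power2_eq_square algebra_simps split: split_indicator)
    ultimately have sq: "integrable M (\<lambda>\<omega>. (indicator A \<omega> - g \<omega>)\<^sup>2)" using A gi by simp
    have "(l1 (indicator A) g)\<^sup>2 \<le> (\<integral>\<omega>. (indicator A \<omega> - g \<omega>)\<^sup>2 \<partial>M)"
      by (rule l1_square_le[OF _ gi(1) sq]) (use A in simp)
    then have "l1 (indicator A) g \<le> sqrt (\<integral>\<omega>. (indicator A \<omega> - g \<omega>)\<^sup>2 \<partial>M)"
      by (rule real_le_rsqrt)
    then have "l1 (d i) (indicator A) < e" using g(2) by (simp add: i l1_commute)
    then show "\<exists>i. l1 (d i) (indicator A) < e" ..
  qed
qed

lemma geometric_tendsto_0:
  assumes "\<And>n. n \<ge> i \<Longrightarrow> f n \<le> c * (1/2::real) ^ n" "\<And>n. 0 \<le> f n"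
  shows "f \<longlonglongrightarrow> 0"
proof (rule tendsto_sandwich[OF _ _ tendsto_const])
  show "(\<lambda>n. c * (1/2::real) ^ n) \<longlonglongrightarrow> 0"
    using tendsto_mult_right_zero[OF LIMSEQ_power_zero[of "1/2::real"]] by simp
  show "\<forall>\<^sub>F n in sequentially. f n \<le> c * (1/2) ^ n"
    using assms(1) by (auto simp: eventually_sequentially)
qed (use assms(2) in simp)

lemma tails_tendsto_liminf:
  assumes X: "\<And>n. X n \<in> sigma_fields M"
  shows "sf_tendsto (\<lambda>n. \<Inter>k. X (n + k)) (liminf_field M X)"
  unfolding liminf_field_def
proof (rule sf_tendsto_increasing)
  show "(\<Inter>k. X (n + k)) \<in> sigma_fields M" for n by (rule INT_sigma_fields) (use X in auto)
  fix m n :: nat assume "m \<le> n"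
  then have "n + k = m + (n - m + k)" for k by simp
  then show "(\<Inter>k. X (m + k)) \<subseteq> (\<Inter>k. X (n + k))" by (metis INT_lower UNIV_I INT_greatest)
qed

lemma liminf_sigma_field:
  assumes X: "\<And>n. X n \<in> sigma_fields M"
  shows "liminf_field M X \<in> sigma_fields M"
  unfolding liminf_field_def
  by (rule sup_field_in_sigma_fields, rule image_subsetI, rule INT_sigma_fields) (use X in auto)

text \<open>
  An event that belongs to almost all \<open>X n\<close> is fixed by their conditional expectations, hence by the
  limit.
\<close>
lemma eventually_common_event:
  assumes X: "\<And>n. X n \<in> sigma_fields M" and x: "x \<in> sigma_fields M" and lim: "sf_tendsto X x"
    and A: "\<And>k. A \<in> X (n + k)"
  shows "A \<in> x"
proof -
  have AM: "A \<in> sets M" by (rule sigma_field_events[OF X A])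
  have Ai: "integrable M (indicator A :: 'a \<Rightarrow> real)" using AM by simp
  have "l1 (cexp (X (k + n)) (indicator A)) (cexp x (indicator A))
      = l1 (indicator A) (cexp x (indicator A))" for k
    using A[of k]
    by (intro l1_cong_AE cexp_indicator_fixes X Ai cexp_integrable x AE_I2[OF refl])
      (simp add: add.commute)
  then have "(\<lambda>k. l1 (indicator A) (cexp x (indicator A))) \<longlonglongrightarrow> 0"
    using LIMSEQ_ignore_initial_segment[OF sf_tendstoD[OF lim Ai], of n] by simp
  then have "l1 (indicator A) (cexp x (indicator A)) = 0" by (simp add: LIMSEQ_const_iff)
  then have "AE \<omega> in M. indicator A \<omega> = cexp x (indicator A) \<omega>"
    by (intro l1_eq_0_AE Ai cexp_integrable x) simp
  then have "AE \<omega> in M. cexp x (indicator A) \<omega> = indicator A \<omega>" by eventually_elim simp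
  then have "(indicator A :: 'a \<Rightarrow> real) \<in> borel_measurable (fld x)"
    by (rule measurable_fldI_cexp[OF x Ai])
  then show ?thesis using indicator_measurable_fld_iff[OF x sets.sets_into_space[OF AM]] by simp
qed

end

text \<open>
  The sequence \<open>d\<close> carries the separability assumption: convergence of sigma-fields has to be
  tested only on the countably many functions \<open>d i\<close>, which makes diagonal arguments possible.
\<close>
locale commuting_sigma_fields = prob_space M for M :: "'a measure" +
  fixes B :: "'a set set set" and d :: "nat \<Rightarrow> 'a \<Rightarrow> real"
  assumes B_sigma_fields: "x \<in> B \<Longrightarrow> x \<in> sigma_fields M"
    and B_meet: "x \<in> B \<Longrightarrow> y \<in> B \<Longrightarrow> x \<inter> y \<in> B"
    and B_preserves: "x \<in> B \<Longrightarrow> y \<in> B \<Longrightarrow> preserves x y"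
    and d_integrable: "integrable M (d i)"
    and d_dense: "A \<in> sets M \<Longrightarrow> e > 0 \<Longrightarrow> \<exists>i. l1 (d i) (indicator A) < e"
begin

text \<open>
  The closure of \<open>B\<close> in the strong operator topology of the conditional expectations.
\<close>
definition strong_closure :: "'a set set set" where
  "strong_closure = {x \<in> sigma_fields M. \<exists>X. (\<forall>n. X n \<in> B) \<and> sf_tendsto X x}"

lemma strong_closure_sigma_fields: "x \<in> strong_closure \<Longrightarrow> x \<in> sigma_fields M"
  by (simp add: strong_closure_def)

lemma strong_closureD:
  assumes "x \<in> strong_closure"
  shows "\<exists>X. (\<forall>n. X n \<in> B) \<and> (\<forall>n. X n \<in> sigma_fields M) \<and> sf_tendsto X x"
  using assms B_sigma_fields unfolding strong_closure_def by blast

lemma strong_closureI: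
  assumes "\<And>n. X n \<in> B" "sf_tendsto X x" "x \<in> sigma_fields M"
  shows "x \<in> strong_closure"
  using assms by (auto simp: strong_closure_def)

lemma B_subset_strong_closure: "x \<in> B \<Longrightarrow> x \<in> strong_closure"
  by (rule strong_closureI[OF _ sf_tendsto_const B_sigma_fields])

lemma sf_tendsto_dense:
  assumes X: "\<And>n. X n \<in> sigma_fields M" and x: "x \<in> sigma_fields M"
    and lim: "\<And>i. (\<lambda>n. l1 (cexp (X n) (d i)) (cexp x (d i))) \<longlonglongrightarrow> 0"
  shows "sf_tendsto X x"
proof (rule sf_tendstoI[OF X x], rule cexp_tendsto_l1_closed[OF X x])
  fix A assume "A \<in> sets M"
  then show "integrable M (indicator A :: 'a \<Rightarrow> real)" by simp
  fix e :: real assume "e > 0"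
  with d_dense[OF \<open>A \<in> sets M\<close>] obtain i where "l1 (d i) (indicator A) < e" by blast
  then show "\<exists>g. integrable M g \<and> l1 g (indicator A) < e \<and>
      (\<lambda>n. l1 (cexp (X n) g) (cexp x g)) \<longlonglongrightarrow> 0"
    using d_integrable lim by blast
qed

lemma fast_sequence_tendsto:
  assumes X: "\<And>n. X n \<in> sigma_fields M" and x: "x \<in> sigma_fields M"
    and fast: "\<And>n i. i \<le> n \<Longrightarrow> l1 (cexp (X n) (d i)) (cexp x (d i)) \<le> (1/2) ^ n"
  shows "sf_tendsto X x"
proof (rule sf_tendsto_dense[OF X x])
  fix i
  show "(\<lambda>n. l1 (cexp (X n) (d i)) (cexp x (d i))) \<longlonglongrightarrow> 0"
    by (rule geometric_tendsto_0[of i _ 1]) (simp_all add: fast)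
qed

lemma sf_tendsto_approx:
  assumes "sf_tendsto X x" "e > 0"
  shows "\<exists>n. \<forall>i\<le>k. l1 (cexp (X n) (d i)) (cexp x (d i)) < e"
proof -
  have "\<forall>\<^sub>F n in sequentially. l1 (cexp (X n) (d i)) (cexp x (d i)) < e" for i
    using sf_tendstoD[OF assms(1) d_integrable] assms(2) by (rule order_tendstoD)
  then have "\<forall>\<^sub>F n in sequentially. \<forall>i\<in>{..k}. l1 (cexp (X n) (d i)) (cexp x (d i)) < e"
    by (simp add: eventually_ball_finite_distrib)
  then show ?thesis by (auto simp: eventually_sequentially)
qed

lemma fast_sequence_exists:
  assumes approx: "\<And>k e. e > 0 \<Longrightarrow> \<exists>b\<in>B. \<forall>i\<le>k. l1 (cexp b (d i)) (cexp x (d i)) < e"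
  shows "\<exists>X. (\<forall>n. X n \<in> B) \<and> (\<forall>n. \<forall>i\<le>n. l1 (cexp (X n) (d i)) (cexp x (d i)) \<le> (1/2) ^ n)"
proof -
  have "\<forall>n. \<exists>b. b \<in> B \<and> (\<forall>i\<le>n. l1 (cexp b (d i)) (cexp x (d i)) < (1/2) ^ n)"
    using approx[OF zero_less_power[of "1/2::real"]] by (simp add: Bex_def)
  then obtain X where X: "\<forall>n. X n \<in> B \<and> (\<forall>i\<le>n. l1 (cexp (X n) (d i)) (cexp x (d i)) < (1/2) ^ n)"
    by metis
  show ?thesis by (rule exI[of _ X]) (use X in \<open>auto intro: less_imp_le\<close>)
qed

lemma strong_closure_approx:
  assumes "x \<in> strong_closure" "e > 0"
  shows "\<exists>b\<in>B. \<forall>i\<le>k. l1 (cexp b (d i)) (cexp x (d i)) < e"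
proof -
  obtain X where X: "\<And>n. X n \<in> B" "\<And>n. X n \<in> sigma_fields M" "sf_tendsto X x"
    using strong_closureD[OF assms(1)] by blast
  from sf_tendsto_approx[OF X(3) assms(2), of k] X(1) show ?thesis by blast
qed

text \<open>
  The diagonal argument. Being a limit of members of \<open>B\<close> is equivalent to being approximable by a
  single member of \<open>B\<close> on the first \<open>k\<close> test functions, for every \<open>k\<close> and every accuracy, and the
  latter condition survives limits.
\<close>
lemma strong_closure_closed:
  assumes X: "\<And>n. X n \<in> strong_closure" and x: "x \<in> sigma_fields M" and lim: "sf_tendsto X x"
  shows "x \<in> strong_closure"
proof -
  have "\<exists>b\<in>B. \<forall>i\<le>k. l1 (cexp b (d i)) (cexp x (d i)) < e" if e: "e > 0" for k e
  proof -
    obtain n where n: "\<forall>i\<le>k. l1 (cexp (X n) (d i)) (cexp x (d i)) < e / 2"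
      using sf_tendsto_approx[OF lim half_gt_zero[OF e]] by blast
    obtain b where b: "b \<in> B" "\<forall>i\<le>k. l1 (cexp b (d i)) (cexp (X n) (d i)) < e / 2"
      using strong_closure_approx[OF X half_gt_zero[OF e]] by blast
    have "l1 (cexp b (d i)) (cexp x (d i)) < e" if "i \<le> k" for i
      using l1_triangle[OF cexp_integrable[OF B_sigma_fields[OF b(1)] d_integrable]
          cexp_integrable[OF strong_closure_sigma_fields[OF X] d_integrable]
          cexp_integrable[OF x d_integrable], of i i n i] b(2) n that by fastforce
    with b(1) show ?thesis by blast
  qed
  from fast_sequence_exists[OF this] obtain Y where Y: "\<And>n. Y n \<in> B"
    "\<And>n i. i \<le> n \<Longrightarrow> l1 (cexp (Y n) (d i)) (cexp x (d i)) \<le> (1/2) ^ n"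
    by blast
  have "sf_tendsto Y x" by (rule fast_sequence_tendsto[OF B_sigma_fields[OF Y(1)] x Y(2)])
  then show ?thesis by (rule strong_closureI[OF Y(1) _ x])
qed

text \<open>
  The limit is taken in one argument at a time: preservation passes to limits in the operator, and
  symmetry exchanges the two arguments between the steps.
\<close>
lemma strong_closure_preserves:
  assumes x: "x \<in> strong_closure" and y: "y \<in> strong_closure"
  shows "preserves x y"
proof -
  have B_strong_closure: "preserves z b" if z: "z \<in> strong_closure" and b: "b \<in> B" for z b
  proof -
    obtain Z where Z: "\<And>n. Z n \<in> B" "\<And>n. Z n \<in> sigma_fields M" "sf_tendsto Z z"
      using strong_closureD[OF z] by blast
    show ?thesis
      by (rule preserves_limit[OF Z(2) strong_closure_sigma_fields[OF z] B_sigma_fields[OF b]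
            B_preserves[OF Z(1) b] Z(3)])
  qed
  obtain X where X: "\<And>n. X n \<in> B" "\<And>n. X n \<in> sigma_fields M" "sf_tendsto X x"
    using strong_closureD[OF x] by blast
  note sf = strong_closure_sigma_fields[OF x] strong_closure_sigma_fields[OF y]
  have "preserves (X n) y" for n
    by (rule preserves_sym[OF sf(2) X(2) B_strong_closure[OF y X(1)]])
  then show ?thesis by (rule preserves_limit[OF X(2) sf _ X(3)])
qed

lemma strong_closure_meet:
  assumes x: "x \<in> strong_closure" and y: "y \<in> strong_closure"
  shows "x \<inter> y \<in> strong_closure"
proof -
  obtain X where X: "\<And>n. X n \<in> B" "\<And>n. X n \<in> sigma_fields M" "sf_tendsto X x"
    using strong_closureD[OF x] by blast
  obtain Y where Y: "\<And>n. Y n \<in> B" "\<And>n. Y n \<in> sigma_fields M" "sf_tendsto Y y"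
    using strong_closureD[OF y] by blast
  have "sf_tendsto (\<lambda>n. X n \<inter> Y n) (x \<inter> y)"
    by (rule sf_tendsto_meet[OF X(2) strong_closure_sigma_fields[OF x] Y(2) strong_closure_sigma_fields[OF y]
          B_preserves[OF X(1) Y(1)] strong_closure_preserves[OF x y] X(3) Y(3)])
  then show ?thesis
    by (rule strong_closureI[OF B_meet[OF X(1) Y(1)] _
          Int_sigma_fields[OF strong_closure_sigma_fields[OF x] strong_closure_sigma_fields[OF y]]])
qed

text \<open>
  The finite meets by which \<open>\<Inter>k. X (n + k)\<close> is reached inside \<open>B\<close>.
\<close>
definition tail_meet :: "(nat \<Rightarrow> 'a set set) \<Rightarrow> nat \<Rightarrow> nat \<Rightarrow> 'a set set" where
  "tail_meet X n m = (\<Inter>k\<le>m. X (n + k))"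

lemma tail_meet_Suc: "tail_meet X n (Suc m) = tail_meet X n m \<inter> X (n + Suc m)"
  by (auto simp: tail_meet_def atMost_Suc)

lemma tail_meet_in_B:
  assumes "\<And>n. X n \<in> B"
  shows "tail_meet X n m \<in> B"
proof (induction m)
  case 0 then show ?case by (simp add: tail_meet_def assms)
next
  case (Suc m) then show ?case unfolding tail_meet_Suc by (rule B_meet[OF _ assms])
qed

lemma tail_meet_tendsto:
  assumes X: "\<And>n. X n \<in> B"
  shows "sf_tendsto (tail_meet X n) (\<Inter>k. X (n + k))"
proof -
  have "sf_tendsto (tail_meet X n) (\<Inter>m. tail_meet X n m)"
    by (rule sf_tendsto_decreasing[OF B_sigma_fields[OF tail_meet_in_B[OF X]]])
      (auto simp: tail_meet_def)
  also have "(\<Inter>m. tail_meet X n m) = (\<Inter>k. X (n + k))" by (auto simp: tail_meet_def)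
  finally show ?thesis .
qed

lemma liminf_in_strong_closure:
  assumes X: "\<And>n. X n \<in> B"
  shows "liminf_field M X \<in> strong_closure"
proof (rule strong_closure_closed[OF _ liminf_sigma_field tails_tendsto_liminf])
  show sf: "X n \<in> sigma_fields M" for n by (rule B_sigma_fields[OF X])
  then show "X n \<in> sigma_fields M" for n .
  fix n
  have "(\<Inter>k. X (n + k)) \<in> sigma_fields M" by (rule INT_sigma_fields) (use sf in auto)
  then show "(\<Inter>k. X (n + k)) \<in> strong_closure"
    by (rule strong_closureI[OF tail_meet_in_B[OF X] tail_meet_tendsto[OF X]])
qed

text \<open>
  The lower limit is always contained in the limit. For the converse it suffices to recover the
  functions \<open>g = cexp x (d i)\<close>. Since the sigma-fields commute, \<open>cexp (X j)\<close> moves \<open>g\<close> by at most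
  \<open>(1/2) ^ j\<close>. Conditioning on the meet of \<open>X n\<close>, \<open>X (n + 1)\<close> and so on is the successive
  conditioning on all of them, so it moves \<open>g\<close> by at most the sum of these bounds, which tends to zero
  with growing \<open>n\<close>. Thus \<open>g\<close> is a limit of functions that are measurable for the lower limit.
\<close>
lemma fast_sequence_liminf:
  assumes x: "x \<in> strong_closure" and X: "\<And>n. X n \<in> B"
    and fast: "\<And>n i. i \<le> n \<Longrightarrow> l1 (cexp (X n) (d i)) (cexp x (d i)) \<le> (1/2) ^ n"
  shows "liminf_field M X = x"
proof
  define s where "s = liminf_field M X"
  note xs = strong_closure_sigma_fields[OF x] and Xs = B_sigma_fields[OF X]
  have s: "s \<in> sigma_fields M" unfolding s_def by (rule liminf_sigma_field[OF Xs])
  have lim: "sf_tendsto X x" by (rule fast_sequence_tendsto[OF Xs xs fast])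
  show "liminf_field M X \<subseteq> x"
    unfolding liminf_field_def
  proof (rule sup_field_least[OF xs])
    fix y assume "y \<in> range (\<lambda>n. \<Inter>k. X (n + k))"
    then obtain n where y: "y = (\<Inter>k. X (n + k))" by auto
    \<comment> \<open>The terms of the increasing supremum consist of events common to a tail of the sequence.\<close>
    show "y \<subseteq> x"
      unfolding y by (rule subsetI, rule eventually_common_event[OF Xs xs lim]) auto
  qed
  have g_meas: "cexp x (d i) \<in> borel_measurable (fld s)" for i
  proof -
    define g where "g = cexp x (d i)"
    have g: "integrable M g" "g \<in> borel_measurable (fld x)"
      unfolding g_def by (rule cexp_integrable[OF xs d_integrable] cexp_measurable)+
    have step: "l1 (cexp (X j) g) g \<le> (1/2) ^ j" if "i \<le> j" for j
    proof -
      note i1 = cexp_integrable[OF Xs[of j] d_integrable[of i]]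
      have "AE \<omega> in M. cexp (X j) g \<omega> = cexp x (cexp (X j) (d i)) \<omega>"
        using preserves_cexp_cexp[OF Xs xs strong_closure_preserves[OF B_subset_strong_closure[OF X] x] d_integrable, of j i]
          preserves_cexp_cexp[OF xs Xs strong_closure_preserves[OF x B_subset_strong_closure[OF X]] d_integrable, of j i]
        unfolding g_def Int_commute[of x] by eventually_elim simp
      moreover have "AE \<omega> in M. g \<omega> = cexp x g \<omega>"
        using cexp_fixes[OF xs g] by eventually_elim simp
      ultimately have "l1 (cexp (X j) g) g = l1 (cexp x (cexp (X j) (d i))) (cexp x g)"
        by (rule l1_cong_AE) (intro cexp_integrable xs Xs g i1)+
      also have "\<dots> \<le> l1 (cexp (X j) (d i)) g" by (rule cexp_l1_contraction[OF xs i1 g(1)])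
      also have "\<dots> \<le> (1/2) ^ j" unfolding g_def by (rule fast[OF that])
      finally show ?thesis .
    qed
    have TB: "tail_meet X n m \<in> B" for n m by (rule tail_meet_in_B[OF X])
    have Ts: "tail_meet X n m \<in> sigma_fields M" for n m by (rule B_sigma_fields[OF TB])
    have partial: "l1 (cexp (tail_meet X n m) g) g \<le> 2 * (1/2) ^ n - (1/2) ^ (n + m)"
      if n: "i \<le> n" for n m
    proof (induction m)
      case 0 then show ?case using step[OF n] by (simp add: tail_meet_def)
    next
      case (Suc m)
      \<comment> \<open>The subtracted power in the bound makes the geometric sum close up under induction.\<close>
      let ?T = "tail_meet X n m" and ?Y = "X (n + Suc m)"
      note i2 = cexp_integrable[OF Xs[of "n + Suc m"] g(1)] cexp_integrable[OF Ts[of n m] g(1)]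
      have "AE \<omega> in M. cexp (?T \<inter> ?Y) g \<omega> = cexp ?T (cexp ?Y g) \<omega>"
        using preserves_cexp_cexp[OF Ts Xs B_preserves[OF TB X] g(1), of n m "n + Suc m"]
        by eventually_elim simp
      then have "l1 (cexp (tail_meet X n (Suc m)) g) g = l1 (cexp ?T (cexp ?Y g)) g"
        unfolding tail_meet_Suc
        by (rule l1_cong_AE[OF _ AE_I2[OF refl]])
          (intro cexp_integrable Int_sigma_fields Ts Xs g)+
      also have "\<dots> \<le> l1 (cexp ?T (cexp ?Y g)) (cexp ?T g) + l1 (cexp ?T g) g"
        by (rule l1_triangle) (intro cexp_integrable Ts Xs g)+
      also have "l1 (cexp ?T (cexp ?Y g)) (cexp ?T g) \<le> l1 (cexp ?Y g) g"
        by (rule cexp_l1_contraction[OF Ts i2(1) g(1)])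
      also have "\<dots> \<le> (1/2) ^ (n + Suc m)" by (rule step) (use n in simp)
      finally show ?case using Suc.IH by simp
    qed
    have tail: "l1 (cexp (\<Inter>k. X (n + k)) g) g \<le> 2 * (1/2) ^ n" if n: "i \<le> n" for n
    proof -
      let ?A = "\<Inter>k. X (n + k)"
      have A: "?A \<in> sigma_fields M" by (rule INT_sigma_fields) (use Xs in auto)
      have "l1 (cexp ?A g) g - 2 * (1/2) ^ n \<le> l1 (cexp (tail_meet X n m) g) (cexp ?A g)" for m
      proof -
        have "l1 (cexp ?A g) g \<le> l1 (cexp ?A g) (cexp (tail_meet X n m) g) + l1 (cexp (tail_meet X n m) g) g"
          by (rule l1_triangle) (intro cexp_integrable A Ts g)+
        moreover have "0 \<le> (1/2::real) ^ (n + m)" by simp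
        ultimately show ?thesis
          using partial[OF n, of m] l1_commute[of "cexp ?A g" "cexp (tail_meet X n m) g"]
          by linarith
      qed
      then have "l1 (cexp ?A g) g - 2 * (1/2) ^ n \<le> 0"
        by (intro LIMSEQ_le_const[OF sf_tendstoD[OF tail_meet_tendsto[of X n, OF X] g(1)]]) auto
      then show ?thesis by simp
    qed
    have As: "(\<Inter>k. X (n + k)) \<in> sigma_fields M" for n by (rule INT_sigma_fields) (use Xs in auto)
    have "g \<in> borel_measurable (fld s)"
    proof (rule measurable_fld_l1_closed[OF s g(1) cexp_integrable[OF As g(1)]])
      show "cexp (\<Inter>k. X (n + k)) g \<in> borel_measurable (fld s)" for n
        by (rule measurable_fld_mono[OF _ As s cexp_measurable])
          (unfold s_def liminf_field_def, rule sup_field_upper, rule rangeI)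
      show "(\<lambda>n. l1 (cexp (\<Inter>k. X (n + k)) g) g) \<longlonglongrightarrow> 0"
        by (rule geometric_tendsto_0[OF tail]) simp_all
    qed
    then show ?thesis by (simp add: g_def)
  qed
  show "x \<subseteq> liminf_field M X"
  proof
    fix A assume A: "A \<in> x"
    have AM: "A \<in> sets M" by (rule sigma_field_events[OF xs A])
    have Ai: "integrable M (indicator A :: 'a \<Rightarrow> real)" using AM by simp
    have "\<forall>k. \<exists>i. l1 (d i) (indicator A) < (1/2) ^ k" using d_dense[OF AM] by simp
    then obtain r where r: "\<And>k. l1 (d (r k)) (indicator A) < (1/2) ^ k" by metis
    have "(indicator A :: 'a \<Rightarrow> real) \<in> borel_measurable (fld s)"
    proof (rule measurable_fld_l1_closed[OF s Ai cexp_integrable[OF xs d_integrable] g_meas])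
      have "l1 (cexp x (d (r k))) (indicator A) \<le> 1 * (1/2) ^ k" for k
      proof -
        have "l1 (cexp x (d (r k))) (cexp x (indicator A)) = l1 (cexp x (d (r k))) (indicator A)"
          by (rule l1_cong_AE[OF AE_I2[OF refl] cexp_indicator_fixes[OF xs A]])
            (intro cexp_integrable xs d_integrable Ai)+
        then show ?thesis
          using cexp_l1_contraction[OF xs d_integrable Ai, of "r k"] r[of k] by simp
      qed
      then show "(\<lambda>k. l1 (cexp x (d (r k))) (indicator A)) \<longlonglongrightarrow> 0"
        by (intro geometric_tendsto_0[of 0 _ 1]) auto
    qed
    then show "A \<in> liminf_field M X"
      using indicator_measurable_fld_iff[OF s sets.sets_into_space[OF AM]] by (simp add: s_def)
  qed
qed

lemma noise_closure_eq_strong_closure: "noise_closure M B = strong_closure"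
proof
  show "noise_closure M B \<subseteq> strong_closure" using liminf_in_strong_closure by (auto simp: noise_closure_def)
  show "strong_closure \<subseteq> noise_closure M B"
  proof
    fix x assume x: "x \<in> strong_closure"
    obtain X where "\<And>n. X n \<in> B"
      "\<And>n i. i \<le> n \<Longrightarrow> l1 (cexp (X n) (d i)) (cexp x (d i)) \<le> (1/2) ^ n"
      using fast_sequence_exists[OF strong_closure_approx[OF x]] by blast
    with fast_sequence_liminf[OF x this] show "x \<in> noise_closure M B"
      unfolding noise_closure_def by blast
  qed
qed

end

section \<open>The completion\<close>
lemma complementary_sym: "complementary M x y \<Longrightarrow> complementary M y x"
  by (simp add: complementary_def join_field_def insert_commute Int_commute)

locale noise_boolean_algebra = prob_space M for M :: "'a measure" +
  fixes B :: "'a set set set" and d :: "nat \<Rightarrow> 'a \<Rightarrow> real"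
  assumes noise: "noise_type_boolean_algebra M B"
    and dense_integrable: "integrable M (d i)"
    and dense_approx: "A \<in> sets M \<Longrightarrow> e > 0 \<Longrightarrow> \<exists>i. l1 (d i) (indicator A) < e"
begin

lemma
  shows noise_sigma_fields: "x \<in> B \<Longrightarrow> x \<in> sigma_fields M"
    and noise_meet: "x \<in> B \<Longrightarrow> y \<in> B \<Longrightarrow> x \<inter> y \<in> B"
    and noise_join: "x \<in> B \<Longrightarrow> y \<in> B \<Longrightarrow> join_field M x y \<in> B"
    and noise_distrib: "x \<in> B \<Longrightarrow> y \<in> B \<Longrightarrow> z \<in> B \<Longrightarrow>
      x \<inter> join_field M y z = join_field M (x \<inter> y) (x \<inter> z)"
    and noise_complement: "x \<in> B \<Longrightarrow> \<exists>x'\<in>B. complementary M x x'"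
    and noise_indep: "x \<in> B \<Longrightarrow> y \<in> B \<Longrightarrow> complementary M x y \<Longrightarrow> indep_set x y"
proof -
  note * = noise[unfolded noise_type_boolean_algebra_def, THEN conjunct1]
    noise[unfolded noise_type_boolean_algebra_def, THEN conjunct2, THEN conjunct1]
    noise[unfolded noise_type_boolean_algebra_def, THEN conjunct2, THEN conjunct2, THEN conjunct1]
    noise[unfolded noise_type_boolean_algebra_def, THEN conjunct2, THEN conjunct2, THEN conjunct2,
      THEN conjunct1]
    noise[unfolded noise_type_boolean_algebra_def, THEN conjunct2, THEN conjunct2, THEN conjunct2,
      THEN conjunct2, THEN conjunct2, THEN conjunct2, THEN conjunct1]
    noise[unfolded noise_type_boolean_algebra_def, THEN conjunct2, THEN conjunct2, THEN conjunct2,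
      THEN conjunct2, THEN conjunct2, THEN conjunct2, THEN conjunct2]
  show "x \<in> B \<Longrightarrow> x \<in> sigma_fields M" using *(1) by (rule subsetD)
  show "x \<in> B \<Longrightarrow> y \<in> B \<Longrightarrow> x \<inter> y \<in> B" using *(2) by blast
  show "x \<in> B \<Longrightarrow> y \<in> B \<Longrightarrow> join_field M x y \<in> B" using *(3) by blast
  show "x \<in> B \<Longrightarrow> y \<in> B \<Longrightarrow> z \<in> B \<Longrightarrow>
      x \<inter> join_field M y z = join_field M (x \<inter> y) (x \<inter> z)" using *(4) by blast
  show "x \<in> B \<Longrightarrow> \<exists>x'\<in>B. complementary M x x'" using *(5) by (rule bspec)
  show "x \<in> B \<Longrightarrow> y \<in> B \<Longrightarrow> complementary M x y \<Longrightarrow> indep_set x y"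
    using *(6) by blast
qed

lemma noise_split:
  assumes "x \<in> B" "y \<in> B" "y' \<in> B" "complementary M y y'"
  shows "x = join_field M (x \<inter> y) (x \<inter> y')"
proof -
  have "x \<inter> join_field M y y' = x"
    using assms(4) noise_sigma_fields[OF assms(1)] by (auto simp: complementary_def sigma_fields_def)
  then show ?thesis using noise_distrib[OF assms(1-3)] by simp
qed

lemma noise_preserves:
  assumes x: "x \<in> B" and y: "y \<in> B"
  shows "preserves x y"
proof -
  obtain x' where x': "x' \<in> B" "complementary M x x'" using noise_complement[OF x] by blast
  show ?thesis
    by (rule preserves_of_splitting[OF noise_sigma_fields[OF x] noise_sigma_fields[OF x'(1)]
          noise_indep[OF x x'] noise_sigma_fields[OF y] noise_split[OF y x x']])
qed

sublocale commuting_sigma_fields M B d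
  by unfold_locales
    (fact noise_sigma_fields noise_meet noise_preserves dense_integrable dense_approx)+

lemma strong_closure_indep:
  assumes "x \<in> strong_closure" "y \<in> strong_closure" "complementary M x y"
  shows "indep_set x y"
  by (rule indep_set_of_preserves[OF strong_closure_sigma_fields strong_closure_sigma_fields strong_closure_preserves])
    (use assms in \<open>auto simp: complementary_def\<close>)

text \<open>
  Splittings along a fixed complementary pair extend from \<open>B\<close> to its closure.
\<close>
lemma strong_closure_split_limit:
  assumes y: "y \<in> strong_closure" "y' \<in> strong_closure" "complementary M y y'"
    and split: "\<And>b. b \<in> B \<Longrightarrow> b = join_field M (b \<inter> y) (b \<inter> y')"
    and x: "x \<in> strong_closure"
  shows "x = join_field M (x \<inter> y) (x \<inter> y')"
proof -
  obtain X where X: "\<And>n. X n \<in> B" "\<And>n. X n \<in> sigma_fields M" "sf_tendsto X x"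
    using strong_closureD[OF x] by blast
  have gen: "join_field M y y' = sets M" using y(3) by (simp add: complementary_def)
  show ?thesis
    by (rule splitting_limit[OF strong_closure_sigma_fields[OF y(1)] strong_closure_sigma_fields[OF y(2)] strong_closure_indep[OF y]
          gen X(2) strong_closure_sigma_fields[OF x] X(3) strong_closure_preserves[OF B_subset_strong_closure[OF X(1)] y(1)]
          strong_closure_preserves[OF B_subset_strong_closure[OF X(1)] y(2)] split[OF X(1)]])
qed

text \<open>
  The pieces of \<open>y\<close> and \<open>y'\<close> inside \<open>b\<close> generate \<open>u\<close>, those inside the complement \<open>b'\<close> generate \<open>v\<close>.
  As \<open>y\<close> and \<open>y'\<close> split along \<open>b\<close> and together generate everything, so do \<open>u\<close> and \<open>v\<close>. Independence
  of \<open>b\<close> and \<open>b'\<close> then forces \<open>u = b\<close>.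
\<close>
lemma noise_split_of_strong_closure:
  assumes b: "b \<in> B" and y: "y \<in> strong_closure" "y' \<in> strong_closure" "complementary M y y'"
  shows "b = join_field M (b \<inter> y) (b \<inter> y')"
proof -
  obtain b' where b': "b' \<in> B" "complementary M b b'" using noise_complement[OF b] by blast
  note bs = noise_sigma_fields[OF b] and bs' = noise_sigma_fields[OF b'(1)]
  note ys = strong_closure_sigma_fields[OF y(1)] and ys' = strong_closure_sigma_fields[OF y(2)]
  have split: "x = join_field M (x \<inter> b) (x \<inter> b')" if "x \<in> strong_closure" for x
    by (rule strong_closure_split_limit[OF B_subset_strong_closure[OF b] B_subset_strong_closure[OF b'(1)] b'(2) noise_split[OF _ b b'] that])
  define u where "u = join_field M (b \<inter> y) (b \<inter> y')"
  define v where "v = join_field M (b' \<inter> y) (b' \<inter> y')"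
  have u: "u \<in> sigma_fields M" unfolding u_def by (intro join_in_sigma_fields Int_sigma_fields bs ys ys')
  have v: "v \<in> sigma_fields M" unfolding v_def by (intro join_in_sigma_fields Int_sigma_fields bs' ys ys')
  have ub: "u \<subseteq> b" unfolding u_def by (rule join_least[OF bs]) auto
  have vb: "v \<subseteq> b'" unfolding v_def by (rule join_least[OF bs']) auto
  have j: "join_field M u v \<in> sigma_fields M" by (rule join_in_sigma_fields[OF u v])
  have part: "b \<inter> y \<subseteq> join_field M u v" "b \<inter> y' \<subseteq> join_field M u v"
    "b' \<inter> y \<subseteq> join_field M u v" "b' \<inter> y' \<subseteq> join_field M u v"
    using join_upper1[of u v] join_upper2[of v u] join_upper1[of "b \<inter> y" "b \<inter> y'"]
      join_upper2[of "b \<inter> y'" "b \<inter> y"] join_upper1[of "b' \<inter> y" "b' \<inter> y'"]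
      join_upper2[of "b' \<inter> y'" "b' \<inter> y"]
    unfolding u_def v_def by blast+
  have "join_field M (y \<inter> b) (y \<inter> b') \<subseteq> join_field M u v"
    by (rule join_least[OF j]) (use part in \<open>auto simp: Int_commute\<close>)
  then have "y \<subseteq> join_field M u v" using split[OF y(1)] by simp
  moreover have "join_field M (y' \<inter> b) (y' \<inter> b') \<subseteq> join_field M u v"
    by (rule join_least[OF j]) (use part in \<open>auto simp: Int_commute\<close>)
  then have "y' \<subseteq> join_field M u v" using split[OF y(2)] by simp
  ultimately have "join_field M y y' \<subseteq> join_field M u v" by (rule join_least[OF j])
  then have gen: "join_field M u v = sets M"
    using y(3) j by (auto simp: complementary_def sigma_fields_def)
  have "u = b" by (rule generating_part_is_all[OF bs bs' noise_indep[OF b b'] u ub v vb gen])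
  then show ?thesis by (simp add: u_def)
qed

lemma strong_closure_split:
  assumes "x \<in> strong_closure" "y \<in> strong_closure" "y' \<in> strong_closure" "complementary M y y'"
  shows "x = join_field M (x \<inter> y) (x \<inter> y')"
  by (rule strong_closure_split_limit[OF assms(2-4) noise_split_of_strong_closure[OF _ assms(2-4)] assms(1)])

text \<open>
  Approximate \<open>v\<close> by \<open>V n\<close> in \<open>B\<close>. Removing from \<open>V n\<close> its part in \<open>b\<close> confines it to the complement
  \<open>b'\<close>, where joining with \<open>b\<close> is continuous; by splitting, the limit \<open>v \<inter> b'\<close> of the remaining parts
  has the same join with \<open>b\<close> as \<open>v\<close>.
\<close>
lemma strong_closure_join_noise:
  assumes b: "b \<in> B" and v: "v \<in> strong_closure"
  shows "join_field M b v \<in> strong_closure"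
proof -
  obtain b' where b': "b' \<in> B" "complementary M b b'" using noise_complement[OF b] by blast
  note bs = noise_sigma_fields[OF b] and bs' = noise_sigma_fields[OF b'(1)] and vs = strong_closure_sigma_fields[OF v]
  note K = B_subset_strong_closure[OF b] B_subset_strong_closure[OF b'(1)]
  obtain V where V: "\<And>n. V n \<in> B" "\<And>n. V n \<in> sigma_fields M" "sf_tendsto V v"
    using strong_closureD[OF v] by blast
  have gen: "join_field M b b' = sets M" using b'(2) by (simp add: complementary_def)
  have "sf_tendsto (\<lambda>n. V n \<inter> b') (v \<inter> b')"
    by (rule sf_tendsto_meet[OF V(2) vs bs' bs' B_preserves[OF V(1) b'(1)] strong_closure_preserves[OF v K(2)]
          V(3) sf_tendsto_const])
  then have "sf_tendsto (\<lambda>n. join_field M b (V n \<inter> b')) (join_field M b (v \<inter> b'))"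
    by (rule sf_tendsto_join[OF bs bs' noise_indep[OF b b'] gen Int_sigma_fields[OF V(2) bs'] Int_lower2
          Int_sigma_fields[OF vs bs'] Int_lower2])
  then have "sf_tendsto (\<lambda>n. join_field M b (V n \<inter> b')) (join_field M b v)"
    unfolding join_absorb[OF bs vs bs' strong_closure_split[OF v K b'(2)]] .
  then show ?thesis
    by (rule strong_closureI[OF noise_join[OF b noise_meet[OF V(1) b'(1)]] _ join_in_sigma_fields[OF bs vs]])
qed

text \<open>
  The same with \<open>v\<close> in the role of \<open>b\<close> and approximation of \<open>x\<close>. The approximating joins are no longer
  in \<open>B\<close>, but they are in its closure by the preceding lemma, and the closure is closed.
\<close>
lemma strong_closure_join:
  assumes x: "x \<in> strong_closure" and v: "v \<in> strong_closure" "v' \<in> strong_closure" "complementary M v v'"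
  shows "join_field M x v \<in> strong_closure"
proof -
  note xs = strong_closure_sigma_fields[OF x] and vs = strong_closure_sigma_fields[OF v(1)] and vs' = strong_closure_sigma_fields[OF v(2)]
  obtain X where X: "\<And>n. X n \<in> B" "\<And>n. X n \<in> sigma_fields M" "sf_tendsto X x"
    using strong_closureD[OF x] by blast
  note XK = B_subset_strong_closure[OF X(1)]
  have gen: "join_field M v v' = sets M" using v(3) by (simp add: complementary_def)
  have "sf_tendsto (\<lambda>n. X n \<inter> v') (x \<inter> v')"
    by (rule sf_tendsto_meet[OF X(2) xs vs' vs' strong_closure_preserves[OF XK v(2)] strong_closure_preserves[OF x v(2)]
          X(3) sf_tendsto_const])
  then have "sf_tendsto (\<lambda>n. join_field M v (X n \<inter> v')) (join_field M v (x \<inter> v'))"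
    by (rule sf_tendsto_join[OF vs vs' strong_closure_indep[OF v] gen Int_sigma_fields[OF X(2) vs'] Int_lower2
          Int_sigma_fields[OF xs vs'] Int_lower2])
  moreover have "join_field M v (X n \<inter> v') = join_field M (X n) v" for n
    unfolding join_absorb[OF vs X(2) vs' strong_closure_split[OF XK v]] by (rule join_commute)
  moreover have "join_field M v (x \<inter> v') = join_field M x v"
    unfolding join_absorb[OF vs xs vs' strong_closure_split[OF x v]] by (rule join_commute)
  ultimately have "sf_tendsto (\<lambda>n. join_field M (X n) v) (join_field M x v)" by simp
  then show ?thesis
    by (rule strong_closure_closed[OF strong_closure_join_noise[OF X(1) v(1)] join_in_sigma_fields[OF xs vs]])
qed

lemma strong_closure_join_meet_complement:
  assumes z: "z \<in> strong_closure" and y: "y \<in> strong_closure" "y' \<in> strong_closure" "complementary M y y'"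
  shows "join_field M y z \<inter> y' = z \<inter> y'"
proof -
  note zs = strong_closure_sigma_fields[OF z] and ys = strong_closure_sigma_fields[OF y(1)] and ys' = strong_closure_sigma_fields[OF y(2)]
  have "join_field M (z \<inter> y') y \<inter> y' = z \<inter> y'"
    by (rule modular_law[OF ys' ys indep_set_commute[OF strong_closure_indep[OF y]] Int_sigma_fields[OF zs ys']
          Int_lower2 ys order_refl])
  then show ?thesis
    using join_absorb[OF ys zs ys' strong_closure_split[OF z y]] by (simp add: join_commute)
qed

text \<open>
  De Morgan's law. The meet is trivial because the join of \<open>x'\<close> and \<open>y'\<close> has only \<open>y' \<inter> x\<close> in common
  with \<open>x\<close>; the join is everything because it contains both parts of \<open>x\<close> in its splitting along
  \<open>y\<close>, as well as \<open>x'\<close>.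
\<close>
lemma complementary_meet:
  assumes x: "x \<in> strong_closure" "x' \<in> strong_closure" "complementary M x x'"
    and y: "y \<in> strong_closure" "y' \<in> strong_closure" "complementary M y y'"
  shows "complementary M (x \<inter> y) (join_field M x' y')"
  unfolding complementary_def
proof
  note xs = strong_closure_sigma_fields[OF x(1)] and xs' = strong_closure_sigma_fields[OF x(2)]
    and ys = strong_closure_sigma_fields[OF y(1)] and ys' = strong_closure_sigma_fields[OF y(2)]
  note j' = join_in_sigma_fields[OF xs' ys']
  have "join_field M x' y' \<inter> x = y' \<inter> x"
    by (rule strong_closure_join_meet_complement[OF y(2) x(2,1) complementary_sym[OF x(3)]])
  then have "x \<inter> y \<inter> join_field M x' y' \<subseteq> y \<inter> y'" by blast
  also have "y \<inter> y' = trivial_field M" using y(3) by (simp add: complementary_def)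
  finally show "x \<inter> y \<inter> join_field M x' y' = trivial_field M"
    using trivial_field_least[OF Int_sigma_fields[OF Int_sigma_fields[OF xs ys] j']] by blast
  define w where "w = join_field M (x \<inter> y) (join_field M x' y')"
  have w: "w \<in> sigma_fields M"
    unfolding w_def by (rule join_in_sigma_fields[OF Int_sigma_fields[OF xs ys] j'])
  have le: "x \<inter> y \<subseteq> w" "x' \<subseteq> w" "y' \<subseteq> w"
    using join_upper1[of "x \<inter> y" "join_field M x' y'"] join_upper2[of "join_field M x' y'" "x \<inter> y"]
      join_upper1[of x' y'] join_upper2[of y' x'] unfolding w_def by blast+
  have "join_field M (x \<inter> y) (x \<inter> y') \<subseteq> w" by (rule join_least[OF w]) (use le in auto)
  then have "x \<subseteq> w" using strong_closure_split[OF x(1) y] by simp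
  then have "join_field M x x' \<subseteq> w" using le(2) by (rule join_least[OF w])
  then show "join_field M (x \<inter> y) (join_field M x' y') = sets M"
    using x(3) w unfolding w_def by (auto simp: complementary_def sigma_fields_def)
qed

lemma completion_iff:
  "x \<in> noise_completion M B \<longleftrightarrow> x \<in> strong_closure \<and> (\<exists>y\<in>strong_closure. complementary M x y)"
  by (simp add: noise_completion_def noise_closure_eq_strong_closure)

lemma noise_subset_completion: "B \<subseteq> noise_completion M B"
proof
  fix x assume x: "x \<in> B"
  obtain x' where "x' \<in> B" "complementary M x x'" using noise_complement[OF x] by blast
  then show "x \<in> noise_completion M B"
    using B_subset_strong_closure[OF x] B_subset_strong_closure[of x'] unfolding completion_iff by blast
qed

lemma completion_meet:
  assumes "x \<in> noise_completion M B" "y \<in> noise_completion M B"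
  shows "x \<inter> y \<in> noise_completion M B"
proof -
  obtain x' y' where x: "x \<in> strong_closure" "x' \<in> strong_closure" "complementary M x x'"
    and y: "y \<in> strong_closure" "y' \<in> strong_closure" "complementary M y y'"
    using assms by (auto simp: completion_iff)
  show ?thesis
    using strong_closure_meet[OF x(1) y(1)] strong_closure_join[OF x(2) y(2,1) complementary_sym[OF y(3)]]
      complementary_meet[OF x y] by (auto simp: completion_iff)
qed

lemma completion_join:
  assumes "x \<in> noise_completion M B" "y \<in> noise_completion M B"
  shows "join_field M x y \<in> noise_completion M B"
proof -
  obtain x' y' where x: "x \<in> strong_closure" "x' \<in> strong_closure" "complementary M x x'"
    and y: "y \<in> strong_closure" "y' \<in> strong_closure" "complementary M y y'"
    using assms by (auto simp: completion_iff)
  show ?thesis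
    using strong_closure_meet[OF x(2) y(2)] strong_closure_join[OF x(1) y]
      complementary_sym[OF complementary_meet[OF x(2,1) complementary_sym[OF x(3)]
          y(2,1) complementary_sym[OF y(3)]]]
    by (auto simp: completion_iff)
qed

text \<open>
  The left side is split along \<open>y\<close> and \<open>y'\<close>. Its part in \<open>y\<close> is contained in \<open>x \<inter> y\<close>, and its part in
  \<open>y'\<close> in \<open>x \<inter> z\<close>, since the join of \<open>y\<close> and \<open>z\<close> has only \<open>z \<inter> y'\<close> in common
  with \<open>y'\<close>.
\<close>
lemma completion_distrib:
  assumes "x \<in> noise_completion M B" "y \<in> noise_completion M B" "z \<in> noise_completion M B"
  shows "x \<inter> join_field M y z = join_field M (x \<inter> y) (x \<inter> z)"
proof
  obtain y' where y: "y \<in> strong_closure" "y' \<in> strong_closure" "complementary M y y'"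
    using assms by (auto simp: completion_iff)
  have x: "x \<in> strong_closure" and z: "z \<in> strong_closure" and yz: "join_field M y z \<in> strong_closure"
    using assms completion_join[OF assms(2,3)] by (auto simp: completion_iff)
  note xs = strong_closure_sigma_fields[OF x] and ys = strong_closure_sigma_fields[OF y(1)] and zs = strong_closure_sigma_fields[OF z]
  define w where "w = join_field M (x \<inter> y) (x \<inter> z)"
  have w: "w \<in> sigma_fields M"
    unfolding w_def by (rule join_in_sigma_fields[OF Int_sigma_fields[OF xs ys] Int_sigma_fields[OF xs zs]])
  have le: "x \<inter> y \<subseteq> w" "x \<inter> z \<subseteq> w" unfolding w_def by (rule join_upper1 join_upper2)+
  define t where "t = x \<inter> join_field M y z"
  have t: "t \<in> strong_closure" unfolding t_def by (rule strong_closure_meet[OF x yz])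
  have "t \<inter> y \<subseteq> w" using le(1) by (auto simp: t_def)
  moreover have "t \<inter> y' \<subseteq> w"
    using le(2) strong_closure_join_meet_complement[OF z y] by (auto simp: t_def)
  ultimately have "join_field M (t \<inter> y) (t \<inter> y') \<subseteq> w" by (rule join_least[OF w])
  then show "x \<inter> join_field M y z \<subseteq> join_field M (x \<inter> y) (x \<inter> z)"
    using strong_closure_split[OF t y] by (simp add: t_def w_def)
  have "x \<inter> join_field M y z \<in> sigma_fields M" by (rule Int_sigma_fields[OF xs strong_closure_sigma_fields[OF yz]])
  then show "join_field M (x \<inter> y) (x \<inter> z) \<subseteq> x \<inter> join_field M y z"
    by (rule join_least) (use join_upper1[of y z] join_upper2[of z y] in auto)
qed

lemma completion_noise_type: "noise_type_boolean_algebra M (noise_completion M B)"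
  unfolding noise_type_boolean_algebra_def
proof (intro conjI ballI impI)
  show "noise_completion M B \<subseteq> sigma_fields M"
    using strong_closure_sigma_fields by (auto simp: completion_iff)
  have "trivial_field M \<in> B" using noise unfolding noise_type_boolean_algebra_def by (elim conjE)
  moreover have "sets M \<in> B" using noise unfolding noise_type_boolean_algebra_def by (elim conjE)
  ultimately show "trivial_field M \<in> noise_completion M B" "sets M \<in> noise_completion M B"
    using noise_subset_completion by auto
  show "\<exists>x'\<in>noise_completion M B. complementary M x x'" if "x \<in> noise_completion M B" for x
  proof -
    obtain y where y: "x \<in> strong_closure" "y \<in> strong_closure" "complementary M x y"
      using \<open>x \<in> noise_completion M B\<close> unfolding completion_iff by blast
    then have "y \<in> noise_completion M B"
      using complementary_sym[OF y(3)] unfolding completion_iff by blast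
    with y(3) show ?thesis by blast
  qed
  show "indep_set x x'"
    if "x \<in> noise_completion M B" "x' \<in> noise_completion M B" "complementary M x x'" for x x'
    by (rule strong_closure_indep) (use that in \<open>simp_all add: completion_iff\<close>)
qed (fact completion_meet completion_join completion_distrib)+

end

theorem theorem1p7:
  fixes M :: "'a measure" and B :: "'a set set set"
  assumes "prob_space M"
    and "separable_L2 M"
    and "noise_type_boolean_algebra M B"
  shows "noise_type_boolean_algebra M (noise_completion M B) \<and>
      B \<subseteq> noise_completion M B \<and>
      noise_completion M B \<subseteq> noise_closure M B \<and>
      (\<forall>C1. noise_type_boolean_algebra M C1 \<and> B \<subseteq> C1 \<and> C1 \<subseteq> noise_closure M B
        \<longrightarrow> C1 \<subseteq> noise_completion M B)"
proof -
  interpret prob_space M by fact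
  from separable_L2_dense_sequence[OF assms(2)] obtain d :: "nat \<Rightarrow> 'a \<Rightarrow> real"
    where d: "(\<forall>i. integrable M (d i)) \<and>
      (\<forall>A e. A \<in> sets M \<longrightarrow> e > 0 \<longrightarrow> (\<exists>i. l1 (d i) (indicator A) < e))"
    by (rule exE)
  interpret noise_boolean_algebra M B d
    using d by unfold_locales (simp_all add: assms(3))
  have "C1 \<subseteq> noise_completion M B"
    if C1: "noise_type_boolean_algebra M C1" "C1 \<subseteq> noise_closure M B" for C1
  proof -
    have "\<forall>x\<in>C1. \<exists>x'\<in>C1. complementary M x x'"
      using C1(1) unfolding noise_type_boolean_algebra_def by (elim conjE)
    then show ?thesis using C1(2) unfolding noise_completion_def by blast
  qed
  then show ?thesis
    using completion_noise_type noise_subset_completion by (auto simp: noise_completion_def)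
qed

end
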